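(* Let $x\in\mathbb{E}$. The orbit of $x$ under $\operatorname{Aut}\mathbb{E}$ contains a unique point of the form $(0,0,r)$ with $r\in[0,1)$. If $x=(\beta_1+\bar\beta_2\lambda,\ \beta_2+\bar\beta_1\lambda,\ \lambda)$, where $\lambda\in\mathbb{D}$ and $\beta_1,\beta_2\in\mathbb{C}$ satisfy $|\beta_1|+|\beta_2|<1$, then $r$ is given by $$r=\left|\frac{\lambda-\alpha\bar\theta}{\bar\alpha\theta\lambda-1}\right|$$ where $$\alpha=\xi_1\tanh\{\tfrac12\tanh^{-1}(|\beta_1|+|\beta_2|)+\tfrac12\tanh^{-1}(|\beta_1|-|\beta_2|)\},$$ $$\theta=\xi_2\tanh\{\tfrac12\tanh^{-1}(|\beta_1|+|\beta_2|)-\tfrac12\tanh^{-1}(|\beta_1|-|\beta_2|)\},$$ and $\xi_1,\xi_2\in\mathbb{T}$ are such that $\beta_1=|\beta_1|\xi_1$ and $\bar\beta_2=|\beta_2|\xi_2$.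
   Context: $\mathbb{D}$ is the open unit disc and $\mathbb{T}$ the unit circle in $\mathbb{C}$. The tetrablock is the domain $$\mathbb{E}=\{(x_1,x_2,x_3)\in\mathbb{C}^3: 1-x_1z-x_2w+x_3zw\neq 0 \text{ for all } z,w\in\mathbb{C} \text{ with } |z|\leq 1,\ |w|\leq 1\}.$$ $\operatorname{Aut}\mathbb{E}$ is the group of automorphisms of $\mathbb{E}$, i.e. analytic bijective self-maps of $\mathbb{E}$ with analytic inverse. Every $x\in\mathbb{E}$ can be written uniquely as $x=(\beta_1+\bar\beta_2\lambda,\ \beta_2+\bar\beta_1\lambda,\ \lambda)$ with $\lambda\in\mathbb{D}$, $\beta_1,\beta_2\in\mathbb{C}$, $|\beta_1|+|\beta_2|<1$. *)

theory Defs
  imports "HOL-Analysis.Analysis"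
begin

definition tetrablock :: "(complex ^ 3) set" where
  "tetrablock =
     {x. \<forall>z w. cmod z \<le> 1 \<and> cmod w \<le> 1 \<longrightarrow> 1 - x $ 1 * z - x $ 2 * w + x $ 3 * z * w \<noteq> 0}"

text \<open>
  Analyticity in several complex variables: Frechet differentiability at each point with a
  complex-linear derivative. The derivative is taken in a full neighbourhood (\<open>at x\<close>, not
  \<open>at x within S\<close>), so the notion is meant for open \<open>S\<close>.
\<close>

definition analytic_map_on ::
    "(complex ^ 'n \<Rightarrow> complex ^ 'm) \<Rightarrow> (complex ^ 'n) set \<Rightarrow> bool" where
  "analytic_map_on f S \<longleftrightarrow>
     (\<forall>x\<in>S. \<exists>D. (f has_derivative D) (at x) \<and> Vector_Spaces.linear (*s) (*s) D)"

text \<open>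
  An automorphism of \<open>S\<close> is represented by a total function; only its values on \<open>S\<close> matter.
\<close>

definition automorphisms :: "(complex ^ 'n) set \<Rightarrow> (complex ^ 'n \<Rightarrow> complex ^ 'n) set" where
  "automorphisms S =
     {f. bij_betw f S S \<and> analytic_map_on f S \<and> analytic_map_on (inv_into S f) S}"

definition aut_orbit :: "(complex ^ 'n) set \<Rightarrow> complex ^ 'n \<Rightarrow> (complex ^ 'n) set" where
  "aut_orbit S x = (\<lambda>f. f x) ` automorphisms S"

end

theory Submission
  imports Defs "HOL-Complex_Analysis.Riemann_Mapping"
begin

text \<open>
  A point \<open>x\<close> of the tetrablock is encoded by the fractional linear map
  \<open>w \<mapsto> (x\<^sub>1 - x\<^sub>3 w) / (1 - x\<^sub>2 w)\<close>, which maps the closed unit disc into the open one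
  (\<open>tetrablock_iff\<close>). Composing this map with automorphisms of the disc on either side gives
  automorphisms of the tetrablock: on the left \<open>moebius_action\<close>, on the right its conjugate by the
  coordinate swap \<open>flip\<close>.

  For existence and the formula: in the coordinates \<open>(\<beta>1, \<beta>2, l)\<close> the condition that a left action with
  parameter \<open>a\<close> followed by a right action with parameter \<open>b\<close> carries \<open>x\<close> to the axis \<open>{(0, 0, c)}\<close> reads
  \<open>\<beta>1 + a (cnj b) \<beta>2 = a\<close> and \<open>\<beta>2 + b (cnj a) \<beta>1 = b\<close>, independently of \<open>l\<close>. The addition theorem of
  \<open>tanh\<close> says that \<open>a = \<alpha>\<close> and \<open>b = cnj \<theta>\<close> solve these equations (\<open>tanh_half_artanh_relations\<close>), and then
  \<open>\<bar>c\<bar>\<close> is the stated value; a rotation makes \<open>c\<close> nonnegative (\<open>orbit_canonical_form\<close>).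

  For uniqueness: the orbit of the origin under the explicit automorphisms is the royal variety
  \<open>x\<^sub>3 = x\<^sub>1 x\<^sub>2\<close>. Suppose first that every automorphism \<open>F\<close> maps the origin to a point \<open>q\<close> of the royal
  variety. If \<open>F\<close> maps \<open>(0, 0, r)\<close> to \<open>(0, 0, s)\<close>, the analytic function
  \<open>h(l) = (x\<^sub>1 - x\<^sub>3 w) / (1 - x\<^sub>2 w)\<close> with \<open>x = F(0, 0, l)\<close> satisfies \<open>h(0) = q\<^sub>1\<close> and \<open>h(r) = - s w\<close>. For the
  unimodular \<open>w\<close> that puts these two values on opposite sides of \<open>0\<close>, the Schwarz-Pick inequality yields
  \<open>s \<le> r\<close>, and \<open>r \<le> s\<close> follows from the inverse of \<open>F\<close> (\<open>axis_radius_antimono\<close>).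

  It remains to see that no automorphism maps the origin to \<open>p = (0, 0, s)\<close> with \<open>s > 0\<close>
  (\<open>origin_orbit_meets_axis_only_at_origin\<close>). The functions above and their flipped versions restrict to
  extremal functions on the axis for every unimodular \<open>w\<close>. Schwarz-Pick along suitable discs through the
  origin and through \<open>p\<close> therefore forces the derivative of such an automorphism to map the axis direction
  to itself (\<open>axis_direction_rigid\<close>). What distinguishes \<open>p\<close> from the origin are the left inverses of the
  axis, that is, the functions \<open>g\<close> from the tetrablock to the disc with \<open>g(0, 0, l) = l\<close>: writing \<open>(a, b, 1)\<close> for
  the gradient of \<open>g\<close> at \<open>(0, 0, s)\<close>, the automorphisms moving the axis transversally
  give \<open>Re (a u + b (cnj u)) \<le> 1 - s\<close> for all unimodular \<open>u\<close> (\<open>left_inverse_gradient_bound\<close>). Composed with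
  the inverse automorphism and a Moebius map, the functions \<open>(x\<^sub>1 - x\<^sub>3 w) / (1 - x\<^sub>2 w)\<close> become left inverses of the
  axis. This bounds the derivative of the inverse automorphism at \<open>p\<close> by \<open>1 / (1 + s)\<close> in the transversal
  directions, while that of the automorphism at the origin is at most \<open>1 - s\<^sup>2\<close>. The product of the two bounds is
  \<open>1 - s\<close>, but the derivatives are inverse to each other.
\<close>

section \<open>Complex numbers of modulus at most one\<close>

lemma unimodular_cnj: "cmod u = 1 \<Longrightarrow> u * cnj u = 1" "cmod u = 1 \<Longrightarrow> cnj u * u = 1"
  by (metis complex_norm_square of_real_1 power_one, metis complex_norm_square mult.commute of_real_1 power_one)

lemma unimodular_multiplier: "\<exists>u. cmod u = 1 \<and> a * u = complex_of_real (cmod a)"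
  by (rule exI[of _ "if a = 0 then 1 else cnj a / cmod a"])
     (auto simp: norm_divide complex_norm_square[symmetric] power2_eq_square)

lemma unimodular_alignment: "\<exists>w. cmod w = 1 \<and> cmod (p - w * q) = cmod p + cmod q"
proof -
  obtain u v where u: "cmod u = 1" "p * u = cmod p" and v: "cmod v = 1" "q * v = cmod q"
    using unimodular_multiplier by meson
  have uu: "cnj u * u = 1" using u(1) by (rule unimodular_cnj)
  have "cmod (p - (- (cnj u * v)) * q) = cmod ((p - (- (cnj u * v)) * q) * u)"
    using u by (simp add: norm_mult)
  also have "(p - (- (cnj u * v)) * q) * u = p * u + (cnj u * u) * (q * v)" by (simp add: algebra_simps)
  also have "\<dots> = complex_of_real (cmod p + cmod q)" by (simp add: u v uu)
  also have "cmod \<dots> = cmod p + cmod q" unfolding norm_of_real by simp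
  finally have "cmod (p - (- (cnj u * v)) * q) = cmod p + cmod q" .
  moreover have "cmod (- (cnj u * v)) = 1" using u v by (simp add: norm_mult)
  ultimately show ?thesis by blast
qed

lemma one_minus_cnj_mult_nonzero:
  assumes "cmod a < 1" "cmod z < 1"
  shows "1 - cnj a * z \<noteq> 0"
proof
  assume "1 - cnj a * z = 0"
  then have "cmod a * cmod z = 1" by (metis complex_mod_cnj eq_iff_diff_eq_0 norm_mult norm_one)
  then show False using assms by (smt (verit) mult_left_le norm_ge_zero)
qed

text \<open>
  The difference of the squares of the two sides is \<open>(1 - \<bar>a\<bar>\<^sup>2) (\<bar>Q\<bar>\<^sup>2 - \<bar>P\<bar>\<^sup>2)\<close>. This is the homogeneous form
  of the fact that \<open>z \<mapsto> (z - a) / (1 - cnj a z)\<close> preserves the disc.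
\<close>
lemma norm_diff_less_norm_diff:
  fixes a P Q :: complex
  assumes "cmod a < 1" "cmod P < cmod Q"
  shows "cmod (P - a * Q) < cmod (Q - cnj a * P)"
proof -
  have "complex_of_real ((cmod (Q - cnj a * P))\<^sup>2 - (cmod (P - a * Q))\<^sup>2)
      = complex_of_real ((1 - (cmod a)\<^sup>2) * ((cmod Q)\<^sup>2 - (cmod P)\<^sup>2))"
    by (simp add: complex_norm_square del: of_real_power) (simp add: algebra_simps)
  then have "(cmod (Q - cnj a * P))\<^sup>2 - (cmod (P - a * Q))\<^sup>2
      = (1 - (cmod a)\<^sup>2) * ((cmod Q)\<^sup>2 - (cmod P)\<^sup>2)"
    by (simp only: of_real_eq_iff)
  moreover have "(cmod a)\<^sup>2 < 1" "(cmod P)\<^sup>2 < (cmod Q)\<^sup>2"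
    using assms by (auto simp: power_strict_mono abs_square_less_1)
  ultimately have "(cmod (P - a * Q))\<^sup>2 < (cmod (Q - cnj a * P))\<^sup>2"
    by (smt (verit) mult_pos_pos)
  then show ?thesis by (rule power_less_imp_less_base) simp
qed

section \<open>Complex gradients\<close>

text \<open>
  A Frechet derivative given by three complex coefficients is complex linear by construction, so
  analyticity needs no separate side condition, and the inequalities below are inequalities between
  these coefficients.
\<close>
definition has_gradient ::
    "(complex ^ 3 \<Rightarrow> complex) \<Rightarrow> complex \<Rightarrow> complex \<Rightarrow> complex \<Rightarrow> complex ^ 3 \<Rightarrow> bool" where
  "has_gradient g a b c x \<longleftrightarrow> (g has_derivative (\<lambda>h. a * h $ 1 + b * h $ 2 + c * h $ 3)) (at x)"

definition has_some_gradient :: "(complex ^ 3 \<Rightarrow> complex) \<Rightarrow> complex ^ 3 \<Rightarrow> bool" where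
  "has_some_gradient g x \<longleftrightarrow> (\<exists>a b c. has_gradient g a b c x)"

lemma vector3_eq_iff: "x = y \<longleftrightarrow> x $ 1 = y $ 1 \<and> x $ 2 = y $ 2 \<and> x $ 3 = (y :: 'a ^ 3) $ 3"
  by (simp add: vec_eq_iff forall_3)

lemma vector3_collapse: "vector [x $ 1, x $ 2, x $ 3] = (x :: 'a :: zero ^ 3)"
  by (simp add: vector3_eq_iff)

lemma has_derivative_vector3:
  fixes f1 f2 f3 :: "'a::real_normed_vector \<Rightarrow> complex"
  assumes "(f1 has_derivative D1) F" "(f2 has_derivative D2) F" "(f3 has_derivative D3) F"
  shows "((\<lambda>z. vector [f1 z, f2 z, f3 z] :: complex ^ 3) has_derivative
          (\<lambda>h. vector [D1 h, D2 h, D3 h])) F"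
proof -
  have lin: "bounded_linear (axis i :: complex \<Rightarrow> complex ^ 3)" for i
    by (rule linear_conv_bounded_linear[THEN iffD1]) (auto intro!: linearI simp: axis_def vec_eq_iff)
  have split: "(vector [p, q, r] :: complex ^ 3) = axis 1 p + axis 2 q + axis 3 r" for p q r
    by (simp add: vector3_eq_iff axis_def)
  show ?thesis
    unfolding split
    by (intro has_derivative_add bounded_linear.has_derivative[OF lin] assms)
qed

lemma has_gradient_chain:
  assumes g: "has_gradient g a b c (vector [f1 z, f2 z, f3 z])"
    and "(f1 has_derivative D1) (at z)" "(f2 has_derivative D2) (at z)" "(f3 has_derivative D3) (at z)"
  shows "((\<lambda>z. g (vector [f1 z, f2 z, f3 z])) has_derivative
          (\<lambda>h. a * D1 h + b * D2 h + c * D3 h)) (at z)"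
  using has_derivative_compose[OF has_derivative_vector3[OF assms(2-4)] g[unfolded has_gradient_def]]
  by simp

lemma has_gradient_chain_field:
  assumes g: "has_gradient g a b c (vector [f1 z, f2 z, f3 z])"
    and "(f1 has_field_derivative d1) (at z)" "(f2 has_field_derivative d2) (at z)"
      "(f3 has_field_derivative d3) (at z)"
  shows "((\<lambda>z. g (vector [f1 z, f2 z, f3 z])) has_field_derivative a * d1 + b * d2 + c * d3) (at z)"
  using has_gradient_chain[OF g assms(2-4)[unfolded has_field_derivative_def]]
  unfolding has_field_derivative_def
  by (rule has_derivative_eq_rhs) (simp add: fun_eq_iff algebra_simps)

lemma has_gradient_compose:
  assumes g: "has_gradient g a b c (f x)"
    and "has_gradient (\<lambda>y. f y $ 1) m11 m12 m13 x"
      "has_gradient (\<lambda>y. f y $ 2) m21 m22 m23 x"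
      "has_gradient (\<lambda>y. f y $ 3) m31 m32 m33 x"
  shows "has_gradient (\<lambda>y. g (f y)) (a * m11 + b * m21 + c * m31) (a * m12 + b * m22 + c * m32)
           (a * m13 + b * m23 + c * m33) x"
proof -
  have "has_gradient g a b c (vector [f x $ 1, f x $ 2, f x $ 3])"
    using g by (simp add: vector3_collapse)
  from has_gradient_chain[OF this assms(2-4)[unfolded has_gradient_def]] show ?thesis
    unfolding has_gradient_def vector3_collapse
    by (rule has_derivative_eq_rhs) (simp add: algebra_simps)
qed

lemma has_gradient_compose_field:
  assumes g: "has_gradient g a b c x" and m: "(m has_field_derivative d) (at (g x))"
  shows "has_gradient (\<lambda>y. m (g y)) (d * a) (d * b) (d * c) x"
  using has_derivative_compose[OF g[unfolded has_gradient_def] m[unfolded has_field_derivative_def]]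
  unfolding has_gradient_def
  by (rule has_derivative_eq_rhs) (simp add: algebra_simps)

lemma has_gradient_unique:
  assumes "has_gradient g a b c x" "has_gradient g a' b' c' x"
  shows "a = a' \<and> b = b' \<and> c = c'"
proof -
  have "(\<lambda>h. a * h $ 1 + b * h $ 2 + c * h $ 3) = (\<lambda>h::complex^3. a' * h $ 1 + b' * h $ 2 + c' * h $ 3)"
    using assms has_derivative_unique unfolding has_gradient_def by blast
  from this[THEN fun_cong, of "vector [1, 0, 0]"] this[THEN fun_cong, of "vector [0, 1, 0]"]
    this[THEN fun_cong, of "vector [0, 0, 1]"] show ?thesis
    by simp
qed

lemma has_gradient_transform:
  assumes "has_gradient f a b c x" "open S" "x \<in> S" "\<And>y. y \<in> S \<Longrightarrow> f y = g y"
  shows "has_gradient g a b c x"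
  using has_derivative_transform_within_open[OF assms(1)[unfolded has_gradient_def] assms(2-4)]
  unfolding has_gradient_def .

lemma has_gradient_component:
  "has_gradient (\<lambda>y. y $ 1) 1 0 0 x" "has_gradient (\<lambda>y. y $ 2) 0 1 0 x" "has_gradient (\<lambda>y. y $ 3) 0 0 1 x"
  unfolding has_gradient_def by (auto intro!: derivative_eq_intros bounded_linear.has_derivative[OF bounded_linear_vec_nth])

lemma has_gradient_const: "has_gradient (\<lambda>y. k) 0 0 0 x"
  unfolding has_gradient_def by simp

lemma has_gradient_add:
  assumes "has_gradient f a b c x" "has_gradient g a' b' c' x"
  shows "has_gradient (\<lambda>y. f y + g y) (a + a') (b + b') (c + c') x"
  unfolding has_gradient_def
  by (rule has_derivative_eq_rhs[OF has_derivative_add[OF assms[unfolded has_gradient_def]]])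
     (simp add: algebra_simps)

lemma has_gradient_diff:
  assumes "has_gradient f a b c x" "has_gradient g a' b' c' x"
  shows "has_gradient (\<lambda>y. f y - g y) (a - a') (b - b') (c - c') x"
  unfolding has_gradient_def
  by (rule has_derivative_eq_rhs[OF has_derivative_diff[OF assms[unfolded has_gradient_def]]])
     (simp add: algebra_simps)

lemma has_gradient_mult:
  assumes "has_gradient f a b c x" "has_gradient g a' b' c' x"
  shows "has_gradient (\<lambda>y. f y * g y)
           (f x * a' + a * g x) (f x * b' + b * g x) (f x * c' + c * g x) x"
  unfolding has_gradient_def
  by (rule has_derivative_eq_rhs[OF has_derivative_mult[OF assms[unfolded has_gradient_def]]])
     (simp add: algebra_simps)

lemma has_gradient_divide:
  assumes "has_gradient f a b c x" "has_gradient g a' b' c' x" "g x \<noteq> 0"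
  shows "has_gradient (\<lambda>y. f y / g y) ((a * g x - f x * a') / (g x * g x))
           ((b * g x - f x * b') / (g x * g x)) ((c * g x - f x * c') / (g x * g x)) x"
  unfolding has_gradient_def
  by (rule has_derivative_eq_rhs[OF has_derivative_divide'[OF assms(1,2)[unfolded has_gradient_def] assms(3)]])
     (simp add: fun_eq_iff algebra_simps add_divide_distrib diff_divide_distrib)

lemma has_some_gradient_intros:
  "has_some_gradient (\<lambda>y. k) x"
  "has_some_gradient (\<lambda>y. y $ 1) x" "has_some_gradient (\<lambda>y. y $ 2) x" "has_some_gradient (\<lambda>y. y $ 3) x"
  "has_some_gradient f x \<Longrightarrow> has_some_gradient g x \<Longrightarrow> has_some_gradient (\<lambda>y. f y + g y) x"
  "has_some_gradient f x \<Longrightarrow> has_some_gradient g x \<Longrightarrow> has_some_gradient (\<lambda>y. f y - g y) x"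
  "has_some_gradient f x \<Longrightarrow> has_some_gradient g x \<Longrightarrow> has_some_gradient (\<lambda>y. f y * g y) x"
  "has_some_gradient f x \<Longrightarrow> has_some_gradient g x \<Longrightarrow> g x \<noteq> 0 \<Longrightarrow> has_some_gradient (\<lambda>y. f y / g y) x"
  unfolding has_some_gradient_def
  by (blast intro: has_gradient_const has_gradient_component has_gradient_add has_gradient_diff
      has_gradient_mult has_gradient_divide)+

lemma complex_linear_functional:
  fixes D :: "complex ^ 3 \<Rightarrow> complex ^ 3"
  assumes "Vector_Spaces.linear (*s) (*s) D"
  shows "D h = h $ 1 *s D (axis 1 1) + h $ 2 *s D (axis 2 1) + h $ 3 *s D (axis 3 1)"
proof -
  interpret Vector_Spaces.linear "(*s)" "(*s)" D by fact
  have "h = h $ 1 *s axis 1 1 + h $ 2 *s axis 2 1 + h $ 3 *s axis 3 1"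
    by (simp add: vector3_eq_iff axis_def)
  then show ?thesis by (metis add scale)
qed

lemma analytic_map_on_iff_gradients:
  fixes f :: "complex ^ 3 \<Rightarrow> complex ^ 3"
  shows "analytic_map_on f S \<longleftrightarrow> (\<forall>x\<in>S. \<forall>i. has_some_gradient (\<lambda>y. f y $ i) x)"
proof
  assume f: "analytic_map_on f S"
  show "\<forall>x\<in>S. \<forall>i. has_some_gradient (\<lambda>y. f y $ i) x"
  proof (intro ballI allI)
    fix x i assume "x \<in> S"
    then obtain D where D: "(f has_derivative D) (at x)" "Vector_Spaces.linear (*s) (*s) D"
      using f unfolding analytic_map_on_def by blast
    have "has_gradient (\<lambda>y. f y $ i) (D (axis 1 1) $ i) (D (axis 2 1) $ i) (D (axis 3 1) $ i) x"
      unfolding has_gradient_def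
      by (rule has_derivative_eq_rhs[OF bounded_linear.has_derivative[OF bounded_linear_vec_nth D(1)]])
         (subst complex_linear_functional[OF D(2)], simp add: algebra_simps)
    then show "has_some_gradient (\<lambda>y. f y $ i) x" unfolding has_some_gradient_def by blast
  qed
next
  assume R: "\<forall>x\<in>S. \<forall>i. has_some_gradient (\<lambda>y. f y $ i) x"
  show "analytic_map_on f S" unfolding analytic_map_on_def
  proof
    fix x assume "x \<in> S"
    then obtain a b c where g: "has_gradient (\<lambda>y. f y $ i) (a i) (b i) (c i) x" for i
      using R unfolding has_some_gradient_def by metis
    let ?D = "\<lambda>h::complex^3. vector [a 1 * h $ 1 + b 1 * h $ 2 + c 1 * h $ 3,
       a 2 * h $ 1 + b 2 * h $ 2 + c 2 * h $ 3, a 3 * h $ 1 + b 3 * h $ 2 + c 3 * h $ 3] :: complex^3"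
    have "(f has_derivative ?D) (at x)"
      using has_derivative_vector3[OF g[of 1, unfolded has_gradient_def] g[of 2, unfolded has_gradient_def]
        g[of 3, unfolded has_gradient_def]] by (simp add: vector3_collapse)
    moreover have "Vector_Spaces.linear (*s) (*s) ?D"
      by unfold_locales (auto simp: vector3_eq_iff algebra_simps)
    ultimately show "\<exists>D. (f has_derivative D) (at x) \<and> Vector_Spaces.linear (*s) (*s) D" by blast
  qed
qed

section \<open>The tetrablock\<close>

text \<open>
  If \<open>x\<^sub>1 \<noteq> x\<^sub>3 w\<close>, the defining expression vanishes exactly at \<open>z = (1 - x\<^sub>2 w) / (x\<^sub>1 - x\<^sub>3 w)\<close>, so membership says
  that this point lies outside the closed disc. If \<open>x\<^sub>1 = x\<^sub>3 w\<close>, it says that \<open>1 - x\<^sub>2 w\<close> does not vanish.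
\<close>
lemma tetrablock_iff:
  "x \<in> tetrablock \<longleftrightarrow> (\<forall>w. cmod w \<le> 1 \<longrightarrow> cmod (x $ 1 - x $ 3 * w) < cmod (1 - x $ 2 * w))"
proof (intro iffI allI impI)
  fix w assume x: "x \<in> tetrablock" and w: "cmod w \<le> 1"
  have nz: "1 - x $ 1 * z - x $ 2 * w + x $ 3 * z * w \<noteq> 0" if "cmod z \<le> 1" for z
    using x w that unfolding tetrablock_def by blast
  let ?P = "x $ 1 - x $ 3 * w" and ?Q = "1 - x $ 2 * w"
  have Q: "?Q \<noteq> 0" using nz[of 0] by simp
  show "cmod ?P < cmod ?Q"
  proof (rule ccontr)
    assume *: "\<not> cmod ?P < cmod ?Q"
    then have P: "?P \<noteq> 0" using Q by auto
    have small: "cmod (?Q / ?P) \<le> 1" using * P by (simp add: norm_divide divide_le_eq)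
    have "1 - x $ 1 * z - x $ 2 * w + x $ 3 * z * w = ?Q - ?P * z" for z
      by (simp add: algebra_simps)
    from nz[OF small, unfolded this] show False using P by simp
  qed
next
  assume R: "\<forall>w. cmod w \<le> 1 \<longrightarrow> cmod (x $ 1 - x $ 3 * w) < cmod (1 - x $ 2 * w)"
  show "x \<in> tetrablock" unfolding tetrablock_def
  proof (intro CollectI allI impI notI)
    fix z w assume zw: "cmod z \<le> 1 \<and> cmod w \<le> 1" and "1 - x $ 1 * z - x $ 2 * w + x $ 3 * z * w = 0"
    then have "1 - x $ 2 * w = z * (x $ 1 - x $ 3 * w)" by (simp add: algebra_simps)
    then have "cmod (1 - x $ 2 * w) \<le> 1 * cmod (x $ 1 - x $ 3 * w)"
      using zw by (simp add: norm_mult mult_left_le_one_le)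
    then show False using R zw by force
  qed
qed

lemma tetrablock_flip: "vector [x $ 2, x $ 1, x $ 3] \<in> tetrablock \<longleftrightarrow> x \<in> tetrablock"
proof -
  have "1 - x $ 2 * z - x $ 1 * w + x $ 3 * z * w = 1 - x $ 1 * w - x $ 2 * z + x $ 3 * w * z" for z w
    by (simp add: algebra_simps)
  then show ?thesis unfolding tetrablock_def mem_Collect_eq vector_3 by metis
qed

text \<open>
  The bound on \<open>x\<^sub>3\<close> comes from the inequality of \<open>tetrablock_iff\<close> at \<open>w = 1\<close> and \<open>w = - 1\<close>: the parallelogram law
  gives \<open>\<bar>x\<^sub>1\<bar>\<^sup>2 + \<bar>x\<^sub>3\<bar>\<^sup>2 < 1 + \<bar>x\<^sub>2\<bar>\<^sup>2\<close>, and adding the flipped inequality leaves \<open>\<bar>x\<^sub>3\<bar>\<^sup>2 < 1\<close>.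
\<close>
lemma tetrablock_components:
  assumes "x \<in> tetrablock"
  shows "cmod (x $ 1) < 1" "cmod (x $ 2) < 1" "cmod (x $ 3) < 1"
proof -
  have y: "vector [x $ 2, x $ 1, x $ 3] \<in> tetrablock" using assms by (simp add: tetrablock_flip)
  note X = assms[unfolded tetrablock_iff, rule_format] and Y = y[unfolded tetrablock_iff, rule_format]
  show "cmod (x $ 1) < 1" "cmod (x $ 2) < 1" using X[of 0] Y[of 0] by simp_all
  have par: "(cmod p)\<^sup>2 + (cmod q)\<^sup>2 < 1 + (cmod r)\<^sup>2"
    if "cmod (p - q) < cmod (1 - r)" "cmod (p + q) < cmod (1 + r)" for p q r
  proof -
    have "(cmod (p - q))\<^sup>2 + (cmod (p + q))\<^sup>2 < (cmod (1 - r))\<^sup>2 + (cmod (1 + r))\<^sup>2"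
      using that by (intro add_strict_mono power_strict_mono) auto
    then show ?thesis by (simp add: cmod_power2) (simp add: power2_eq_square algebra_simps)
  qed
  have "(cmod (x $ 1))\<^sup>2 + (cmod (x $ 3))\<^sup>2 < 1 + (cmod (x $ 2))\<^sup>2"
    using X[of 1] X[of "-1"] by (intro par) simp_all
  moreover have "(cmod (x $ 2))\<^sup>2 + (cmod (x $ 3))\<^sup>2 < 1 + (cmod (x $ 1))\<^sup>2"
    using Y[of 1] Y[of "-1"] by (intro par) simp_all
  ultimately have "(cmod (x $ 3))\<^sup>2 < 1" by simp
  then show "cmod (x $ 3) < 1" by (simp add: abs_square_less_1)
qed

text \<open>The complement is the projection, along a compact bidisc, of a closed set.\<close>
lemma open_tetrablock: "open tetrablock"
proof -
  let ?K = "cball (0::complex) 1 \<times> cball (0::complex) 1"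
  let ?T = "{p :: (complex \<times> complex) \<times> (complex ^ 3).
     1 - snd p $ 1 * fst (fst p) - snd p $ 2 * snd (fst p) + snd p $ 3 * fst (fst p) * snd (fst p) = 0}"
  have "closed ?T" by (intro closed_Collect_eq continuous_intros)
  moreover have "compact ?K" by (intro compact_Times compact_cball)
  ultimately have cl: "closed {y. \<exists>k. k \<in> ?K \<and> (k, y) \<in> ?T}" by (intro closed_compact_projection)
  have eq: "tetrablock = - {y. \<exists>k. k \<in> ?K \<and> (k, y) \<in> ?T}"
    unfolding tetrablock_def by auto
  show ?thesis unfolding eq by (rule open_Compl[OF cl])
qed

text \<open>On the royal variety \<open>x\<^sub>3 = x\<^sub>1 x\<^sub>2\<close> the defining expression factors.\<close>
lemma royal_disc_in_tetrablock:
  assumes "cmod z < 1" "cmod w < 1"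
  shows "vector [z, w, z * w] \<in> tetrablock"
proof -
  have nz: "1 - z * p \<noteq> 0" if "cmod z < 1" "cmod p \<le> 1" for z p
  proof
    assume "1 - z * p = 0"
    then have "cmod z * cmod p = 1" by (metis eq_iff_diff_eq_0 norm_mult norm_one)
    then show False using that by (smt (verit) mult_left_le norm_ge_zero)
  qed
  have "1 - z * p - w * q + z * w * p * q = (1 - z * p) * (1 - w * q)" for p q
    by (simp add: algebra_simps)
  then show ?thesis using nz assms by (simp add: tetrablock_def)
qed

lemma axis_disc_in_tetrablock: "cmod l < 1 \<Longrightarrow> vector [0, 0, l] \<in> tetrablock"
  by (auto simp: tetrablock_iff norm_mult) (smt (verit) mult_left_le norm_ge_zero)

section \<open>Explicit automorphisms\<close>

text \<open>
  Keeping the inverse as a second map, instead of \<open>inv_into S f\<close>, makes composition and inversion of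
  automorphisms immediate; on an open set the two descriptions agree (\<open>automorphisms_iff\<close>).
\<close>
definition mutually_inverse_on ::
    "(complex ^ 3) set \<Rightarrow> (complex ^ 3 \<Rightarrow> complex ^ 3) \<Rightarrow> (complex ^ 3 \<Rightarrow> complex ^ 3) \<Rightarrow> bool" where
  "mutually_inverse_on S f g \<longleftrightarrow> analytic_map_on f S \<and> analytic_map_on g S \<and>
     (\<forall>x\<in>S. f x \<in> S \<and> g x \<in> S \<and> g (f x) = x \<and> f (g x) = x)"

lemma automorphisms_iff:
  assumes "open S"
  shows "f \<in> automorphisms S \<longleftrightarrow> (\<exists>g. mutually_inverse_on S f g)"
proof
  assume "f \<in> automorphisms S"
  then have f: "bij_betw f S S" "analytic_map_on f S" "analytic_map_on (inv_into S f) S"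
    by (auto simp: automorphisms_def)
  then have "mutually_inverse_on S f (inv_into S f)"
    unfolding mutually_inverse_on_def
    by (auto simp: bij_betw_def inv_into_into f_inv_into_f)
  then show "\<exists>g. mutually_inverse_on S f g" by blast
next
  assume "\<exists>g. mutually_inverse_on S f g"
  then obtain g where g: "analytic_map_on f S" "analytic_map_on g S"
    and fg: "\<And>x. x \<in> S \<Longrightarrow> f x \<in> S \<and> g x \<in> S \<and> g (f x) = x \<and> f (g x) = x"
    unfolding mutually_inverse_on_def by blast
  have bij: "bij_betw f S S" by (rule bij_betwI[where g = g]) (use fg in auto)
  have inv: "g x = inv_into S f x" if "x \<in> S" for x
    using bij fg that by (metis bij_betw_def inv_into_f_f)
  have "analytic_map_on (inv_into S f) S"
    unfolding analytic_map_on_def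
  proof
    fix x assume x: "x \<in> S"
    then obtain D where D: "(g has_derivative D) (at x)" "Vector_Spaces.linear (*s) (*s) D"
      using g(2) unfolding analytic_map_on_def by blast
    have "(inv_into S f has_derivative D) (at x)"
      by (rule has_derivative_transform_within_open[OF D(1) assms x inv])
    then show "\<exists>D. (inv_into S f has_derivative D) (at x) \<and> Vector_Spaces.linear (*s) (*s) D"
      using D(2) by blast
  qed
  then show "f \<in> automorphisms S" using bij g(1) by (simp add: automorphisms_def)
qed

lemma mutually_inverse_on_sym: "mutually_inverse_on S f g \<Longrightarrow> mutually_inverse_on S g f"
  unfolding mutually_inverse_on_def by blast

lemma mutually_inverse_on_compose:
  assumes "mutually_inverse_on S f g" "mutually_inverse_on S f' g'"
  shows "mutually_inverse_on S (\<lambda>x. f' (f x)) (\<lambda>x. g (g' x))"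
proof -
  have comp: "analytic_map_on (\<lambda>x. h (k x)) S"
    if h: "analytic_map_on h S" and k: "analytic_map_on k S" "\<And>x. x \<in> S \<Longrightarrow> k x \<in> S" for h k
    unfolding analytic_map_on_def
  proof
    fix x assume x: "x \<in> S"
    obtain D where D: "(k has_derivative D) (at x)" "Vector_Spaces.linear (*s) (*s) D"
      using k(1) x unfolding analytic_map_on_def by blast
    obtain D' where D': "(h has_derivative D') (at (k x))" "Vector_Spaces.linear (*s) (*s) D'"
      using h k(2)[OF x] unfolding analytic_map_on_def by blast
    show "\<exists>D. ((\<lambda>x. h (k x)) has_derivative D) (at x) \<and> Vector_Spaces.linear (*s) (*s) D"
      using has_derivative_compose[OF D(1) D'(1)] Vector_Spaces.linear_compose[OF D(2) D'(2)]
      by (auto simp: o_def)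
  qed
  show ?thesis
    using assms comp[of f' f] comp[of g g'] unfolding mutually_inverse_on_def by simp
qed

text \<open>
  These are the coordinates of \<open>m \<circ> \<Psi>\<close>, where \<open>\<Psi>(w) = (x\<^sub>1 - x\<^sub>3 w) / (1 - x\<^sub>2 w)\<close> encodes \<open>x\<close> and
  \<open>m(z) = (z - a) / (1 - cnj a z)\<close>. Conjugation with \<open>flip\<close> gives the action by composition on the other side.
\<close>
definition moebius_action :: "complex \<Rightarrow> complex ^ 3 \<Rightarrow> complex ^ 3" where
  "moebius_action a x =
     vector [(x $ 1 - a) / (1 - cnj a * x $ 1), (x $ 2 - cnj a * x $ 3) / (1 - cnj a * x $ 1),
             (x $ 3 - a * x $ 2) / (1 - cnj a * x $ 1)]"

definition flip :: "complex ^ 3 \<Rightarrow> complex ^ 3" where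
  "flip x = vector [x $ 2, x $ 1, x $ 3]"

definition rotation :: "complex \<Rightarrow> complex ^ 3 \<Rightarrow> complex ^ 3" where
  "rotation u x = vector [u * x $ 1, x $ 2, u * x $ 3]"

lemma moebius_action_in_tetrablock:
  assumes a: "cmod a < 1" and x: "x \<in> tetrablock"
  shows "moebius_action a x \<in> tetrablock"
  unfolding tetrablock_iff
proof (intro allI impI)
  fix w assume w: "cmod w \<le> 1"
  let ?d = "1 - cnj a * x $ 1" and ?P = "x $ 1 - x $ 3 * w" and ?Q = "1 - x $ 2 * w"
  have d: "?d \<noteq> 0" using one_minus_cnj_mult_nonzero[OF a] tetrablock_components[OF x] by blast
  have "moebius_action a x $ 1 - moebius_action a x $ 3 * w = (?P - a * ?Q) / ?d"
    "1 - moebius_action a x $ 2 * w = (?Q - cnj a * ?P) / ?d"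
    using d by (simp_all add: moebius_action_def divide_simps) (simp_all add: algebra_simps)
  then show "cmod (moebius_action a x $ 1 - moebius_action a x $ 3 * w) < cmod (1 - moebius_action a x $ 2 * w)"
    using norm_diff_less_norm_diff[OF a x[unfolded tetrablock_iff, rule_format, OF w]] d
    by (simp add: norm_divide divide_strict_right_mono)
qed

lemma moebius_action_inverse:
  assumes a: "cmod a < 1" and x: "x \<in> tetrablock"
  shows "moebius_action (- a) (moebius_action a x) = x"
proof -
  let ?d = "1 - cnj a * x $ 1" and ?y = "moebius_action a x"
  have d: "?d \<noteq> 0" using one_minus_cnj_mult_nonzero[OF a] tetrablock_components[OF x] by blast
  have e: "1 - a * cnj a \<noteq> 0" using one_minus_cnj_mult_nonzero[OF a a] by (simp add: mult.commute)
  have y: "1 + cnj a * ?y $ 1 = (1 - a * cnj a) / ?d" "?y $ 1 + a = (1 - a * cnj a) * x $ 1 / ?d"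
    "?y $ 2 + cnj a * ?y $ 3 = (1 - a * cnj a) * x $ 2 / ?d"
    "?y $ 3 + a * ?y $ 2 = (1 - a * cnj a) * x $ 3 / ?d"
    using d by (simp_all add: moebius_action_def divide_simps) (simp_all add: algebra_simps)
  show ?thesis
    unfolding moebius_action_def[of "- a"] using d e
    by (simp add: y vector3_eq_iff)
qed

lemma analytic_moebius_action:
  assumes a: "cmod a < 1"
  shows "analytic_map_on (moebius_action a) tetrablock"
  unfolding analytic_map_on_iff_gradients moebius_action_def forall_3 vector_3
  using one_minus_cnj_mult_nonzero[OF a] tetrablock_components
  by (intro ballI conjI has_some_gradient_intros) auto

lemma mutually_inverse_moebius_action:
  assumes a: "cmod a < 1"
  shows "mutually_inverse_on tetrablock (moebius_action a) (moebius_action (- a))"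
  using assms analytic_moebius_action moebius_action_in_tetrablock moebius_action_inverse
    moebius_action_inverse[of "- a"] by (simp add: mutually_inverse_on_def)

lemma mutually_inverse_flip: "mutually_inverse_on tetrablock flip flip"
  unfolding mutually_inverse_on_def analytic_map_on_iff_gradients forall_3 flip_def vector_3
  by (intro ballI conjI has_some_gradient_intros) (auto simp: tetrablock_flip vector3_eq_iff)

lemma mutually_inverse_rotation:
  assumes u: "cmod u = 1"
  shows "mutually_inverse_on tetrablock (rotation u) (rotation (cnj u))"
proof -
  have "vector [v * x $ 1, x $ 2, v * x $ 3] \<in> tetrablock" if "cmod v = 1" "x \<in> tetrablock" for v x
  proof -
    have "cmod (v * x $ 1 - v * x $ 3 * w) = cmod (x $ 1 - x $ 3 * w)" for w
      using that(1) by (metis mult.assoc mult.left_neutral norm_mult right_diff_distrib)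
    then show ?thesis using that(2) by (simp add: tetrablock_iff)
  qed
  moreover have "u * cnj u = 1" using u by (rule unimodular_cnj)
  then have "u * (cnj u * z) = z" "cnj u * (u * z) = z" for z
    by (simp_all add: mult.assoc[symmetric] mult.commute[of "cnj u"])
  ultimately show ?thesis
    using u unfolding mutually_inverse_on_def analytic_map_on_iff_gradients forall_3 rotation_def vector_3
    by (intro ballI conjI has_some_gradient_intros) (auto simp: vector3_eq_iff)
qed

section \<open>Every orbit meets the axis\<close>

text \<open>
  If \<open>t = tanh u\<close> and \<open>t' = tanh v\<close>, then \<open>u + v\<close> and \<open>u - v\<close> are the two values of \<open>artanh\<close>. The addition
  theorem therefore evaluates \<open>p + q\<close> and \<open>p - q\<close> in terms of \<open>t\<close> and \<open>t'\<close>; half the sum and half the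
  difference of the two resulting equations are the claims.
\<close>
lemma tanh_half_artanh_relations:
  fixes p q t t' :: real
  assumes pq: "0 \<le> p" "0 \<le> q" "p + q < 1"
    and t: "t = tanh (1 / 2 * artanh (p + q) + 1 / 2 * artanh (p - q))"
    and t': "t' = tanh (1 / 2 * artanh (p + q) - 1 / 2 * artanh (p - q))"
  shows "p + q * t * t' = t" "q + p * t * t' = t'"
proof -
  have tanh_artanh: "tanh (artanh y) = y" if "\<bar>y\<bar> < 1" for y :: real
    using that by (simp add: tanh_real_altdef artanh_def exp_minus field_simps)
  have add: "tanh (u + v) * (1 + tanh u * tanh v) = tanh u + tanh v" for u v :: real
  proof -
    have "\<bar>tanh u * tanh v\<bar> < 1"
      using tanh_real_bounds[of u] tanh_real_bounds[of v] mult_strict_mono[of "\<bar>tanh u\<bar>" 1 "\<bar>tanh v\<bar>" 1]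
      by (auto simp: abs_mult abs_less_iff)
    then show ?thesis by (simp add: tanh_add abs_less_iff)
  qed
  define u where "u = 1 / 2 * artanh (p + q) + 1 / 2 * artanh (p - q)"
  define v where "v = 1 / 2 * artanh (p + q) - 1 / 2 * artanh (p - q)"
  have "u + v = artanh (p + q)" "u + - v = artanh (p - q)" by (simp_all add: u_def v_def)
  moreover have "tanh (artanh (p + q)) = p + q" "tanh (artanh (p - q)) = p - q"
    by (rule tanh_artanh; use pq in simp)+
  moreover have "t = tanh u" "t' = tanh v" using t t' by (simp_all add: u_def v_def)
  ultimately have "(p + q) * (1 + t * t') = t + t'" "(p - q) * (1 - t * t') = t - t'"
    using add[of u v] add[of u "- v"] by simp_all
  then show "p + q * t * t' = t" "q + p * t * t' = t'" by (simp_all add: algebra_simps)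
qed

text \<open>
  The two equations for \<open>a\<close> and \<open>b\<close>, together with their conjugates, say that the left action with parameter
  \<open>a\<close> leads to a point \<open>y\<close> with \<open>y\<^sub>2 = b\<close> and \<open>y\<^sub>1 = (cnj b) y\<^sub>3\<close>. Such a point is moved to \<open>(0, 0, y\<^sub>3)\<close> by the
  right action with parameter \<open>b\<close>. Eliminating \<open>x\<^sub>1\<close> and \<open>x\<^sub>2\<close> from \<open>y\<^sub>3 = (l - a x\<^sub>2) / (1 - (cnj a) x\<^sub>1)\<close> yields the
  value of \<open>r\<close>. The last claim identifies the points that this construction moves to the origin.
\<close>
lemma orbit_canonical_form:
  assumes x: "x \<in> tetrablock"
    and coords: "x = vector [\<beta>1 + cnj \<beta>2 * l, \<beta>2 + cnj \<beta>1 * l, l]"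
    and ab: "cmod a < 1" "cmod b < 1"
    and eqs: "\<beta>1 + a * cnj b * \<beta>2 = a" "\<beta>2 + b * cnj a * \<beta>1 = b"
    and r: "r = cmod ((l - a * b) / (cnj a * cnj b * l - 1))"
  shows "(\<exists>f g. mutually_inverse_on tetrablock f g \<and> f x = vector [0, 0, complex_of_real r]) \<and>
    r < 1 \<and> (r = 0 \<longrightarrow> x $ 3 = x $ 1 * x $ 2)"
proof -
  define y where "y = moebius_action a x"
  define c where "c = y $ 3"
  have l: "cmod l < 1" using tetrablock_components(3)[OF x] coords by simp
  have d: "1 - cnj a * x $ 1 \<noteq> 0"
    using one_minus_cnj_mult_nonzero[OF ab(1)] tetrablock_components[OF x] by blast
  have eqs': "cnj \<beta>1 + cnj a * b * cnj \<beta>2 = cnj a" "cnj \<beta>2 + cnj b * a * cnj \<beta>1 = cnj b"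
    using eqs[THEN arg_cong[where f = cnj]] by simp_all
  have e1: "x $ 1 = a + cnj b * (l - a * x $ 2)"
  proof -
    have "a + cnj b * (l - a * x $ 2) - x $ 1
        = (a - (\<beta>1 + a * cnj b * \<beta>2)) + l * (cnj b - (cnj \<beta>2 + cnj b * a * cnj \<beta>1))"
      by (simp add: coords algebra_simps)
    then show ?thesis using eqs eqs' by simp
  qed
  have e2: "x $ 2 = b + cnj a * (l - b * x $ 1)"
  proof -
    have "b + cnj a * (l - b * x $ 1) - x $ 2
        = (b - (\<beta>2 + b * cnj a * \<beta>1)) + l * (cnj a - (cnj \<beta>1 + cnj a * b * cnj \<beta>2))"
      by (simp add: coords algebra_simps)
    then show ?thesis using eqs eqs' by simp
  qed
  have x3: "x $ 3 = l" by (simp add: coords)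
  have y2: "y $ 2 = b"
    using d e2 by (simp add: y_def moebius_action_def x3 divide_eq_eq) (simp add: algebra_simps)
  have y1: "y $ 1 = cnj b * c"
    using e1 by (simp add: c_def y_def moebius_action_def x3)
  have bb: "1 - cnj b * b \<noteq> 0" using one_minus_cnj_mult_nonzero[OF ab(2) ab(2)] .
  have final: "flip (moebius_action b (flip y)) = vector [0, 0, c]"
    using bb by (simp add: flip_def moebius_action_def vector3_eq_iff y1 y2 c_def[symmetric] divide_eq_eq algebra_simps)
  have c: "cmod c = r"
  proof -
    let ?Z = "l - a * x $ 2"
    have z1: "cmod (cnj a * cnj b * l) < 1"
    proof -
      have "cmod a * cmod b < 1 * 1" using ab by (intro mult_strict_mono) auto
      then have "cmod a * cmod b * cmod l < 1 * 1" using l by (intro mult_strict_mono) auto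
      then show ?thesis by (simp add: norm_mult)
    qed
    then have nz: "cnj a * cnj b * l - 1 \<noteq> 0" by auto
    have "?Z = l - a * (b + cnj a * (l - b * (a + cnj b * ?Z)))" using e1 e2 by metis
    then have Z: "?Z * (1 - a * cnj a * b * cnj b) = (1 - a * cnj a) * (l - a * b)"
      by (simp add: algebra_simps)
    have "(l - a * b) * (1 - cnj a * x $ 1) = (l - a * b) * (1 - cnj a * (a + cnj b * ?Z))"
      using e1 by metis
    also have "\<dots> = (1 - a * cnj a) * (l - a * b) - cnj a * cnj b * ?Z * (l - a * b)"
      by (simp add: algebra_simps)
    also have "\<dots> = ?Z * (1 - cnj a * cnj b * l)" unfolding Z[symmetric] by (simp add: algebra_simps)
    finally have "c = - ((l - a * b) / (cnj a * cnj b * l - 1))"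
      using d nz unfolding c_def y_def moebius_action_def vector_3 x3
      by (simp add: divide_eq_eq eq_divide_eq field_simps)
    then show ?thesis using r by simp
  qed
  obtain u where u: "cmod u = 1" "c * u = complex_of_real r"
    using unimodular_multiplier c by blast
  have "rotation u (flip (moebius_action b (flip (moebius_action a x)))) = vector [0, 0, complex_of_real r]"
    using final u(2) by (simp add: y_def rotation_def mult.commute)
  moreover obtain g where
    "mutually_inverse_on tetrablock (\<lambda>x. rotation u (flip (moebius_action b (flip (moebius_action a x))))) g"
    using mutually_inverse_on_compose[OF mutually_inverse_on_compose[OF mutually_inverse_on_compose[OF
      mutually_inverse_on_compose[OF mutually_inverse_moebius_action[OF ab(1)] mutually_inverse_flip]
      mutually_inverse_moebius_action[OF ab(2)]] mutually_inverse_flip] mutually_inverse_rotation[OF u(1)]]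
    by blast
  moreover have "r < 1"
    using tetrablock_components(3)[OF moebius_action_in_tetrablock[OF ab(1) x]] c by (simp add: c_def y_def)
  moreover have "x $ 3 = x $ 1 * x $ 2" if "r = 0"
  proof -
    have "y $ 3 = 0" using that c by (simp add: c_def)
    then have "l = a * x $ 2" using d by (simp add: y_def moebius_action_def x3)
    then show ?thesis using e1 x3 by simp
  qed
  ultimately show ?thesis by blast
qed

text \<open>
  The two parameters solve a linear system with determinant \<open>1 - \<bar>x\<^sub>3\<bar>\<^sup>2\<close>. The point is to see that
  \<open>\<bar>\<beta>1\<bar> + \<bar>\<beta>2\<bar> < 1\<close>. Along the path \<open>(s x\<^sub>1, s x\<^sub>2, s\<^sup>2 x\<^sub>3)\<close>, which stays in the tetrablock, this sum depends
  continuously on \<open>s\<close> and starts at \<open>0\<close>, so it suffices that it never equals \<open>1\<close>. For unimodular \<open>z\<close> and \<open>w\<close>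
  the defining expression of the tetrablock is \<open>d + m z w (cnj d)\<close> with \<open>d = 1 - \<beta>1 z - \<beta>2 w\<close> and third
  coordinate \<open>m\<close>. If the sum equals \<open>1\<close>, some unimodular \<open>z\<close> and \<open>w\<close> give \<open>d = 0\<close>.
\<close>
lemma foliation_coordinates:
  assumes x: "x \<in> tetrablock"
  obtains \<beta>1 \<beta>2 where "cmod \<beta>1 + cmod \<beta>2 < 1"
    "x = vector [\<beta>1 + cnj \<beta>2 * x $ 3, \<beta>2 + cnj \<beta>1 * x $ 3, x $ 3]"
proof -
  let ?y = "\<lambda>s::real. vector [s * x $ 1, s * x $ 2, s\<^sup>2 * x $ 3] :: complex ^ 3"
  define B1 where "B1 s = (s * x $ 1 - cnj (s * x $ 2) * (s\<^sup>2 * x $ 3)) / (1 - (cmod (s\<^sup>2 * x $ 3))\<^sup>2)" for s :: real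
  define B2 where "B2 s = (s * x $ 2 - cnj (s * x $ 1) * (s\<^sup>2 * x $ 3)) / (1 - (cmod (s\<^sup>2 * x $ 3))\<^sup>2)" for s :: real
  have y: "?y s \<in> tetrablock" if s: "0 \<le> s" "s \<le> 1" for s
    unfolding tetrablock_def
  proof (intro CollectI allI impI)
    fix z w assume zw: "cmod z \<le> 1 \<and> cmod w \<le> 1"
    then have "cmod (s * z) \<le> 1 \<and> cmod (s * w) \<le> 1"
      using s by (auto simp: norm_mult intro!: mult_le_one)
    then have "1 - x $ 1 * (s * z) - x $ 2 * (s * w) + x $ 3 * (s * z) * (s * w) \<noteq> 0"
      using x unfolding tetrablock_def by blast
    then show "1 - ?y s $ 1 * z - ?y s $ 2 * w + ?y s $ 3 * z * w \<noteq> 0"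
      by (simp add: algebra_simps power2_eq_square)
  qed
  have y3: "cmod (s\<^sup>2 * x $ 3) < 1" if "0 \<le> s" "s \<le> 1" for s :: real
    using tetrablock_components(3)[OF y[OF that]] by simp
  have nz: "1 - (cmod (s\<^sup>2 * x $ 3))\<^sup>2 \<noteq> 0" if "0 \<le> s" "s \<le> 1" for s :: real
    using y3[OF that] abs_square_eq_1[of "cmod (s\<^sup>2 * x $ 3)"] by auto
  have eq: "p = (p - cnj q * m) / (1 - (cmod m)\<^sup>2) + cnj ((q - cnj p * m) / (1 - (cmod m)\<^sup>2)) * m"
    if "1 - (cmod m)\<^sup>2 \<noteq> 0" for p q m :: complex
  proof -
    define e where "e = 1 - (complex_of_real (cmod m))\<^sup>2"
    have e: "e = 1 - m * cnj m" unfolding e_def by (metis complex_norm_square of_real_power)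
    have "e \<noteq> 0" using that unfolding e_def by (metis of_real_1 of_real_diff of_real_eq_0_iff of_real_power)
    have "cnj e = e" by (simp add: e_def)
    then have "(p - cnj q * m) / e + cnj ((q - cnj p * m) / e) * m
        = ((p - cnj q * m) + (cnj q - p * cnj m) * m) / e"
      by (simp add: add_divide_distrib)
    also have "\<dots> = p * e / e" by (simp add: e algebra_simps)
    also have "\<dots> = p" using \<open>e \<noteq> 0\<close> by simp
    finally show ?thesis by (simp add: e_def)
  qed
  have coords: "?y s = vector [B1 s + cnj (B2 s) * (s\<^sup>2 * x $ 3), B2 s + cnj (B1 s) * (s\<^sup>2 * x $ 3), s\<^sup>2 * x $ 3]"
    if "0 \<le> s" "s \<le> 1" for s
    using eq[OF nz[OF that], of "s * x $ 1" "s * x $ 2"] eq[OF nz[OF that], of "s * x $ 2" "s * x $ 1"]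
    by (simp add: B1_def B2_def vector3_eq_iff)
  have ne1: "cmod (B1 s) + cmod (B2 s) \<noteq> 1" if s: "0 \<le> s" "s \<le> 1" for s
  proof
    assume sum: "cmod (B1 s) + cmod (B2 s) = 1"
    obtain z w where z: "cmod z = 1" "B1 s * z = cmod (B1 s)" and w: "cmod w = 1" "B2 s * w = cmod (B2 s)"
      using unimodular_multiplier by meson
    let ?m = "s\<^sup>2 * x $ 3"
    have zz: "cnj z * z = 1" "cnj w * w = 1"
      using z(1) w(1) by (simp_all add: unimodular_cnj)
    have D: "1 - B1 s * z - B2 s * w = 0"
      using sum unfolding z(2) w(2) by (metis diff_diff_eq diff_self of_real_1 of_real_add)
    from D have D': "1 - cnj (B1 s) * cnj z - cnj (B2 s) * cnj w = 0"
      by (metis complex_cnj_diff complex_cnj_mult complex_cnj_one complex_cnj_zero)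
    have "1 - ?y s $ 1 * z - ?y s $ 2 * w + ?y s $ 3 * z * w
        = (1 - B1 s * z - B2 s * w) + ?m * z * w * (1 - cnj (B1 s) * (cnj z) - cnj (B2 s) * (cnj w))"
    proof -
      have "?m * z * w * (1 - cnj (B1 s) * (cnj z) - cnj (B2 s) * (cnj w))
          = ?m * z * w - cnj (B1 s) * ?m * w * (cnj z * z) - cnj (B2 s) * ?m * z * (cnj w * w)"
        by (simp add: algebra_simps)
      then show ?thesis unfolding coords[OF s] zz by (simp add: algebra_simps)
    qed
    also have "\<dots> = 0" using D D' by simp
    finally show False using y[OF s] z(1) w(1) unfolding tetrablock_def by fastforce
  qed
  have cont: "continuous_on {0..1} (\<lambda>s. cmod (B1 s) + cmod (B2 s))"
    unfolding B1_def B2_def using nz by (intro continuous_intros) (auto simp flip: of_real_power)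
  have "cmod (B1 1) + cmod (B2 1) < 1"
  proof (rule ccontr)
    assume "\<not> ?thesis"
    then have "\<exists>s\<ge>0. s \<le> 1 \<and> cmod (B1 s) + cmod (B2 s) = 1"
      using cont by (intro IVT') (auto simp: B1_def B2_def)
    then show False using ne1 by blast
  qed
  moreover have "x = vector [B1 1 + cnj (B2 1) * x $ 3, B2 1 + cnj (B1 1) * x $ 3, x $ 3]"
    using coords[of 1] by (simp add: vector3_eq_iff)
  ultimately show ?thesis by (rule that)
qed

section \<open>Analytic functions from the tetrablock to the disc\<close>

text \<open>
  The Schwarz lemma for \<open>f\<close> composed with Moebius maps that move \<open>w\<close> and \<open>f w\<close> to the origin, stated
  without quotients.
\<close>
lemma schwarz_pick:
  assumes f: "f holomorphic_on ball 0 1" and bound: "\<And>z. cmod z < 1 \<Longrightarrow> cmod (f z) < 1"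
    and z: "cmod z < 1" and w: "cmod w < 1"
  shows "cmod (f z - f w) * cmod (1 - cnj w * z) \<le> cmod (z - w) * cmod (1 - cnj (f w) * f z)"
proof -
  let ?M = "Moebius_function 0"
  define g where "g = ?M (f w) \<circ> f \<circ> ?M (- w)"
  have w': "cmod (- w) < 1" using w by simp
  have "g holomorphic_on ball 0 1"
    unfolding g_def
    by (intro holomorphic_on_compose_gen[where t = "ball 0 1"] Moebius_function_holomorphic f bound w w')
       (auto intro: bound Moebius_function_norm_lt_1[OF w'])
  moreover have "g 0 = 0" by (simp add: g_def Moebius_function_of_zero Moebius_function_eq_zero)
  moreover have "cmod (g x) < 1" if "cmod x < 1" for x
    using that by (simp add: g_def Moebius_function_norm_lt_1 bound w w')
  moreover have "cmod (?M w z) < 1" using z w by (rule Moebius_function_norm_lt_1[rotated])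
  ultimately have "cmod (g (?M w z)) \<le> cmod (?M w z)" by (intro Schwarz_Lemma(1))
  moreover have "g (?M w z) = ?M (f w) (f z)"
    using Moebius_function_compose[of "- w" w z] w z by (simp add: g_def)
  ultimately have "cmod ((f z - f w) / (1 - cnj (f w) * f z)) \<le> cmod ((z - w) / (1 - cnj w * z))"
    by (simp add: Moebius_function_simple)
  moreover have "1 - cnj (f w) * f z \<noteq> 0" "1 - cnj w * z \<noteq> 0"
    using one_minus_cnj_mult_nonzero bound z w by auto
  ultimately show ?thesis by (simp add: norm_divide field_simps)
qed

lemma schwarz_pick_derivative:
  assumes f: "f holomorphic_on ball 0 1" and bound: "\<And>z. cmod z < 1 \<Longrightarrow> cmod (f z) < 1"
    and w: "cmod w < 1" and d: "(f has_field_derivative d) (at w)"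
  shows "cmod d * (1 - (cmod w)\<^sup>2) \<le> 1 - (cmod (f w))\<^sup>2"
proof -
  have real: "cmod (1 - cnj z * z) = 1 - (cmod z)\<^sup>2" if "cmod z < 1" for z
  proof -
    have "1 - cnj z * z = complex_of_real (1 - (cmod z)\<^sup>2)"
      by (metis complex_norm_square mult.commute of_real_1 of_real_diff)
    moreover have "0 \<le> 1 - (cmod z)\<^sup>2" using that by (simp add: abs_square_le_1)
    ultimately show ?thesis by (metis norm_of_real abs_of_nonneg)
  qed
  have "((\<lambda>z. (f z - f w) / (z - w)) \<longlongrightarrow> d) (at w)" using d by (simp add: has_field_derivative_iff)
  then have lim1: "((\<lambda>z. cmod ((f z - f w) / (z - w)) * cmod (1 - cnj w * z)) \<longlongrightarrow> cmod d * cmod (1 - cnj w * w)) (at w)"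
    by (intro tendsto_intros)
  have "(f \<longlongrightarrow> f w) (at w)" using d by (metis DERIV_isCont isCont_def)
  then have lim2: "((\<lambda>z. cmod (1 - cnj (f w) * f z)) \<longlongrightarrow> cmod (1 - cnj (f w) * f w)) (at w)"
    by (intro tendsto_intros)
  have "eventually (\<lambda>z. z \<in> ball 0 1) (at w)" using w by (intro eventually_at_in_open') auto
  moreover have "eventually (\<lambda>z. z \<noteq> w) (at w)" by (simp add: eventually_at_filter)
  ultimately have "eventually (\<lambda>z. cmod ((f z - f w) / (z - w)) * cmod (1 - cnj w * z)
      \<le> cmod (1 - cnj (f w) * f z)) (at w)"
  proof eventually_elim
    case (elim z)
    then show ?case using schwarz_pick[OF f bound _ w, of z] by (simp add: norm_divide field_simps)
  qed
  from tendsto_le[OF _ lim2 lim1 this] show ?thesis using real w bound by simp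
qed

text \<open>
  Equality in the infinitesimal inequality makes \<open>f\<close> composed with a Moebius map a linear function, by the equality
  case of the Schwarz lemma.
\<close>
lemma schwarz_pick_extremal:
  assumes f: "f holomorphic_on ball 0 1" and bound: "\<And>z. cmod z < 1 \<Longrightarrow> cmod (f z) < 1"
    and w: "cmod w < 1" and d: "(f has_field_derivative d) (at w)" and fw: "f w = 0"
    and extremal: "cmod d * (1 - (cmod w)\<^sup>2) = 1" and z: "cmod z < 1"
  shows "f z = d * (1 - (cmod w)\<^sup>2) * ((z - w) / (1 - cnj w * z))"
proof -
  let ?M = "Moebius_function 0"
  define g where "g = f \<circ> ?M (- w)"
  have w': "cmod (- w) < 1" using w by simp
  have hol: "g holomorphic_on ball 0 1"
    unfolding g_def
    by (intro holomorphic_on_compose_gen[where t = "ball 0 1"] Moebius_function_holomorphic f w')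
       (auto intro: Moebius_function_norm_lt_1[OF w'])
  have g0: "g 0 = 0" by (simp add: g_def Moebius_function_of_zero fw)
  have gb: "cmod (g x) < 1" if "cmod x < 1" for x
    unfolding g_def o_def by (intro bound Moebius_function_norm_lt_1[OF w' that])
  have "(?M (- w) has_field_derivative 1 - (cmod w)\<^sup>2) (at 0)"
    unfolding Moebius_function_def
    by (auto intro!: derivative_eq_intros simp del: of_real_power simp: complex_norm_square)
  moreover have "?M (- w) 0 = w" by (simp add: Moebius_function_of_zero)
  ultimately have dg: "(g has_field_derivative d * (1 - (cmod w)\<^sup>2)) (at 0)"
    unfolding g_def o_def using d by (metis DERIV_chain2)
  have nn: "0 \<le> 1 - (cmod w)\<^sup>2" using w by (simp add: abs_square_le_1)
  have "cmod (d * complex_of_real (1 - (cmod w)\<^sup>2)) = cmod d * (1 - (cmod w)\<^sup>2)"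
    unfolding norm_mult norm_of_real using nn by simp
  then have "cmod (deriv g 0) = 1" using DERIV_imp_deriv[OF dg] extremal by simp
  then obtain \<alpha> where \<alpha>: "\<And>z. cmod z < 1 \<Longrightarrow> g z = \<alpha> * z"
    using Schwarz_Lemma(3)[OF hol g0 gb, of 0] by auto
  have "(g has_field_derivative \<alpha>) (at 0)"
    by (rule has_field_derivative_transform_within_open[of "\<lambda>z. \<alpha> * z" _ _ "ball 0 1"])
       (auto intro!: derivative_eq_intros simp: \<alpha>)
  then have "\<alpha> = d * (1 - (cmod w)\<^sup>2)" using dg DERIV_unique by blast
  moreover have "f z = g (?M w z)"
    using Moebius_function_compose[of "- w" w z] w z by (simp add: g_def)
  moreover have "cmod (?M w z) < 1" using z w by (rule Moebius_function_norm_lt_1[rotated])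
  ultimately show ?thesis using \<alpha> by (simp add: Moebius_function_simple)
qed

definition disc_function :: "(complex ^ 3 \<Rightarrow> complex) \<Rightarrow> bool" where
  "disc_function g \<longleftrightarrow> (\<forall>x\<in>tetrablock. cmod (g x) < 1 \<and> has_some_gradient g x)"

lemma disc_function_along_disc:
  assumes g: "disc_function g"
    and disc: "\<And>z. cmod z < 1 \<Longrightarrow> vector [f1 z, f2 z, f3 z] \<in> tetrablock"
    and hol: "f1 holomorphic_on ball 0 1" "f2 holomorphic_on ball 0 1" "f3 holomorphic_on ball 0 1"
  shows "(\<lambda>z. g (vector [f1 z, f2 z, f3 z])) holomorphic_on ball 0 1"
    and "\<And>z. cmod z < 1 \<Longrightarrow> cmod (g (vector [f1 z, f2 z, f3 z])) < 1"
proof -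
  show "\<And>z. cmod z < 1 \<Longrightarrow> cmod (g (vector [f1 z, f2 z, f3 z])) < 1"
    using g disc unfolding disc_function_def by blast
  show "(\<lambda>z. g (vector [f1 z, f2 z, f3 z])) holomorphic_on ball 0 1"
    unfolding holomorphic_on_open[OF open_ball]
  proof
    fix z :: complex assume z: "z \<in> ball 0 1"
    then obtain a b c where "has_gradient g a b c (vector [f1 z, f2 z, f3 z])"
      using g disc[of z] unfolding disc_function_def has_some_gradient_def by auto
    from has_gradient_chain_field[of g a b c f1 z f2 f3, OF this]
    show "\<exists>d. ((\<lambda>z. g (vector [f1 z, f2 z, f3 z])) has_field_derivative d) (at z)"
      using hol z unfolding holomorphic_on_open[OF open_ball] by blast
  qed
qed

text \<open>This is Schwarz-Pick along the disc \<open>l \<mapsto> (0, 0, l)\<close>.\<close>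
lemma gradient_bound_axis:
  assumes g: "disc_function g" and grad: "has_gradient g a b c (vector [0, 0, l])" and l: "cmod l < 1"
  shows "cmod c * (1 - (cmod l)\<^sup>2) \<le> 1 - (cmod (g (vector [0, 0, l])))\<^sup>2"
proof -
  have "((\<lambda>z. g (vector [0, 0, z])) has_field_derivative a * 0 + b * 0 + c * 1) (at l)"
    by (rule has_gradient_chain_field[of g a b c "\<lambda>_. 0" l "\<lambda>_. 0" "\<lambda>z. z"])
       (use grad in \<open>auto intro!: derivative_eq_intros\<close>)
  with schwarz_pick_derivative[OF disc_function_along_disc[OF g, of "\<lambda>_. 0" "\<lambda>_. 0" "\<lambda>z. z"] l]
  show ?thesis using axis_disc_in_tetrablock by auto
qed

text \<open>
  The discs \<open>z \<mapsto> (u z, v z, u v z\<^sup>2)\<close> in the royal variety have velocity \<open>(u, v, 0)\<close> at the origin, and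
  the unimodular numbers \<open>u\<close> and \<open>v\<close> can be adapted to the arguments of \<open>a\<close> and \<open>b\<close>.
\<close>
lemma gradient_bound_origin:
  assumes g: "disc_function g" and grad: "has_gradient g a b c (vector [0, 0, 0])"
  shows "cmod a + cmod b \<le> 1 - (cmod (g (vector [0, 0, 0])))\<^sup>2"
proof -
  obtain u v where u: "cmod u = 1" "a * u = cmod a" and v: "cmod v = 1" "b * v = cmod b"
    using unimodular_multiplier by meson
  let ?f = "\<lambda>z. g (vector [u * z, v * z, (u * z) * (v * z)])"
  have disc: "vector [u * z, v * z, (u * z) * (v * z)] \<in> tetrablock" if "cmod z < 1" for z
    using that u v by (intro royal_disc_in_tetrablock) (auto simp: norm_mult)
  have "(?f has_field_derivative a * u + b * v + c * 0) (at 0)"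
    by (rule has_gradient_chain_field) (use grad in \<open>auto intro!: derivative_eq_intros\<close>)
  then have "(?f has_field_derivative complex_of_real (cmod a + cmod b)) (at 0)"
    by (simp add: u v)
  from schwarz_pick_derivative[OF disc_function_along_disc[OF g, of "\<lambda>z. u * z" "\<lambda>z. v * z" "\<lambda>z. (u * z) * (v * z)"] _ this] disc
  have "cmod (complex_of_real (cmod a + cmod b)) \<le> 1 - (cmod (g (vector [0, 0, 0])))\<^sup>2"
    by (auto intro!: holomorphic_intros)
  moreover have "cmod (complex_of_real (cmod a + cmod b)) = cmod a + cmod b"
    unfolding norm_of_real by simp
  ultimately show ?thesis by simp
qed

lemma has_real_derivative_cmod_square:
  assumes "(f has_vector_derivative d) (at t)"
  shows "((\<lambda>t. (cmod (f t))\<^sup>2) has_real_derivative 2 * Re (cnj (f t) * d)) (at t)"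
  using assms unfolding cmod_power2
  by (auto intro!: derivative_eq_intros simp: algebra_simps)

text \<open>
  This disc is the image of the axis under a left and a right action with parameters \<open>- t u\<close> and
  \<open>- t (cnj u)\<close>; for small \<open>t\<close> it is a transversal displacement of the axis.
\<close>
lemma transvection_disc_in_tetrablock:
  fixes t :: real and u m :: complex
  assumes t: "\<bar>t\<bar> < 1" and u: "cmod u = 1" and m: "cmod m < 1"
  shows "vector [t * u * (1 + m) / (1 + t\<^sup>2 * m), t * cnj u * (1 + m) / (1 + t\<^sup>2 * m),
           (m + t\<^sup>2) / (1 + t\<^sup>2 * m)] \<in> tetrablock"
proof -
  have a: "cmod (- (t * u)) < 1" "cmod (- (t * cnj u)) < 1" using t u by (simp_all add: norm_mult)
  have uu: "u * (cnj u * z) = z" for z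
    using unimodular_cnj(1)[OF u] by (simp add: mult.assoc[symmetric])
  have "flip (moebius_action (- (t * cnj u)) (flip (moebius_action (- (t * u)) (vector [0, 0, m]))))
      \<in> tetrablock"
    using axis_disc_in_tetrablock[OF m] moebius_action_in_tetrablock[OF a(1)]
      moebius_action_in_tetrablock[OF a(2)] tetrablock_flip unfolding flip_def by metis
  then show ?thesis
    by (simp add: flip_def moebius_action_def algebra_simps power2_eq_square uu)
qed

text \<open>
  Let \<open>h\<^sub>t\<close> be the restriction of \<open>g\<close> to the displaced axis above. It is a self-map of the disc, and \<open>h\<^sub>0\<close> is
  the identity. Hence the pseudo-hyperbolic distance of \<open>h\<^sub>t(s)\<close> and \<open>h\<^sub>t(0)\<close> is largest at \<open>t = 0\<close>, and its
  derivative vanishes there. This links the gradient at \<open>(0, 0, s)\<close> to the gradient at the origin: with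
  \<open>P = (1 + s) (a u + b (cnj u))\<close> and with \<open>Q\<close> the same combination \<open>a u + b (cnj u)\<close> of the coefficients at the origin,
  \<open>Re P = (1 - s\<^sup>2) (Re Q)\<close>. At the origin \<open>Re Q \<le> 1\<close> by \<open>gradient_bound_origin\<close>.
\<close>
lemma left_inverse_gradient_bound:
  assumes g: "disc_function g" and left_inv: "\<And>l. cmod l < 1 \<Longrightarrow> g (vector [0, 0, l]) = l"
    and s: "0 < s" "s < 1" and grad: "has_gradient g a b c (vector [0, 0, complex_of_real s])"
    and u: "cmod u = 1"
  shows "Re (a * u + b * cnj u) \<le> 1 - s"
proof -
  define h where "h t m = g (vector [t * u * (1 + m) / (1 + t\<^sup>2 * m), t * cnj u * (1 + m) / (1 + t\<^sup>2 * m),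
           (m + t\<^sup>2) / (1 + t\<^sup>2 * m)])" for t m :: complex
  define k0 ks where "k0 t = h (complex_of_real t) 0" and "ks t = h (complex_of_real t) (complex_of_real s)" for t
  have comparison: "cmod (ks t - k0 t) \<le> s * cmod (1 - cnj (k0 t) * ks t)" if t: "\<bar>t\<bar> < 1" for t :: real
  proof -
    have nz: "1 + (complex_of_real t)\<^sup>2 * m \<noteq> 0" if "cmod m < 1" for m
      using one_minus_cnj_mult_nonzero[of "- (complex_of_real (t\<^sup>2))" m] that t
      by (simp add: abs_square_less_1 norm_power)
    have "h t holomorphic_on ball 0 1" and "\<And>m. cmod m < 1 \<Longrightarrow> cmod (h t m) < 1"
      unfolding h_def
      by (rule disc_function_along_disc[OF g transvection_disc_in_tetrablock[OF t u, simplified]];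
          use nz in \<open>auto intro!: holomorphic_intros\<close>)+
    from schwarz_pick[OF this, of s 0] show ?thesis using s by (simp add: k0_def ks_def)
  qed
  obtain a0 b0 c0 where grad0: "has_gradient g a0 b0 c0 (vector [0, 0, 0])"
    using g axis_disc_in_tetrablock[of 0] unfolding disc_function_def has_some_gradient_def by auto
  have D: "(ks has_vector_derivative (1 + s) * (a * u + b * cnj u)) (at 0)"
    "(k0 has_vector_derivative a0 * u + b0 * cnj u) (at 0)"
  proof -
    have curve: "((\<lambda>t. h t m) has_field_derivative a * (u * (1 + m)) + b * (cnj u * (1 + m)) + c * 0) (at 0)"
      if "has_gradient g a b c (vector [0, 0, m])" for a b c m
      unfolding h_def
      by (rule has_gradient_chain_field) (use that in \<open>auto intro!: derivative_eq_intros\<close>)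
    show "(ks has_vector_derivative (1 + s) * (a * u + b * cnj u)) (at 0)"
      unfolding ks_def using has_vector_derivative_real_field[of "\<lambda>t. h t s" _ 0] curve[OF grad]
      by (simp add: algebra_simps)
    show "(k0 has_vector_derivative a0 * u + b0 * cnj u) (at 0)"
      unfolding k0_def using has_vector_derivative_real_field[of "\<lambda>t. h t 0" _ 0] curve[OF grad0]
      by simp
  qed
  have vals: "ks 0 = s" "k0 0 = 0" using left_inv[of s] left_inv[of 0] s by (simp_all add: ks_def k0_def h_def)
  let ?P = "(1 + s) * (a * u + b * cnj u)" and ?Q = "a0 * u + b0 * cnj u"
  have D1: "((\<lambda>t. (cmod (ks t - k0 t))\<^sup>2) has_real_derivative 2 * Re (s * (?P - ?Q))) (at 0)"
    using has_real_derivative_cmod_square[OF has_vector_derivative_diff[OF D]] by (simp only: vals) simp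
  have "((\<lambda>t. 1 - cnj (k0 t) * ks t) has_vector_derivative - (cnj ?Q * s)) (at 0)"
    by (rule derivative_eq_intros bounded_linear.has_vector_derivative[OF bounded_linear_cnj] D refl)+
       (simp add: vals)
  from has_real_derivative_cmod_square[OF this]
  have D2: "((\<lambda>t. (cmod (1 - cnj (k0 t) * ks t))\<^sup>2) has_real_derivative 2 * Re (- (cnj ?Q * s))) (at 0)"
    by (simp only: vals) simp
  from DERIV_diff[OF D1 DERIV_cmult[OF D2]]
  have "((\<lambda>t. (cmod (ks t - k0 t))\<^sup>2 - s\<^sup>2 * (cmod (1 - cnj (k0 t) * ks t))\<^sup>2) has_real_derivative
      2 * Re (s * (?P - ?Q)) - s\<^sup>2 * (2 * Re (- (cnj ?Q * s)))) (at 0)" .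
  then have "2 * Re (s * (?P - ?Q)) - s\<^sup>2 * (2 * Re (- (cnj ?Q * s))) = 0"
  proof (rule DERIV_local_max[where d = 1])
    show "\<forall>t. \<bar>0 - t\<bar> < 1 \<longrightarrow> (cmod (ks t - k0 t))\<^sup>2 - s\<^sup>2 * (cmod (1 - cnj (k0 t) * ks t))\<^sup>2
        \<le> (cmod (ks 0 - k0 0))\<^sup>2 - s\<^sup>2 * (cmod (1 - cnj (k0 0) * ks 0))\<^sup>2"
    proof (intro allI impI)
      fix t :: real assume "\<bar>0 - t\<bar> < 1"
      then have "(cmod (ks t - k0 t))\<^sup>2 \<le> (s * cmod (1 - cnj (k0 t) * ks t))\<^sup>2"
        by (intro power_mono comparison) auto
      then show "(cmod (ks t - k0 t))\<^sup>2 - s\<^sup>2 * (cmod (1 - cnj (k0 t) * ks t))\<^sup>2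
        \<le> (cmod (ks 0 - k0 0))\<^sup>2 - s\<^sup>2 * (cmod (1 - cnj (k0 0) * ks 0))\<^sup>2"
        using s by (simp add: vals power_mult_distrib)
    qed
  qed simp
  then have "2 * s * (Re ?P - (1 - s\<^sup>2) * Re ?Q) = 0"
    by (simp add: algebra_simps power2_eq_square)
  then have "Re ?P = (1 - s\<^sup>2) * Re ?Q" using s by simp
  then have "(1 + s) * Re (a * u + b * cnj u) = (1 + s) * ((1 - s) * Re ?Q)"
    by (simp add: algebra_simps power2_eq_square)
  then have "Re (a * u + b * cnj u) = (1 - s) * Re ?Q" using s by simp
  also have "\<dots> \<le> (1 - s) * 1"
  proof (rule mult_left_mono)
    have "Re ?Q \<le> cmod (a0 * u) + cmod (b0 * cnj u)"
      by (rule order_trans[OF complex_Re_le_cmod norm_triangle_ineq])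
    also have "\<dots> \<le> 1" using gradient_bound_origin[OF g grad0] left_inv[of 0] u by (simp add: norm_mult)
    finally show "Re ?Q \<le> 1" .
  qed (use s in simp)
  finally show ?thesis by simp
qed

text \<open>
  Extremality along the axis makes \<open>g\<close> a Moebius function of \<open>l\<close> there, with \<open>(1 - s\<^sup>2) c\<close> as its unimodular
  factor. Undoing this Moebius map turns \<open>g\<close> into a left inverse of the axis.
\<close>
lemma extremal_gradient_bound:
  assumes g: "disc_function g" and grad: "has_gradient g a b c (vector [0, 0, complex_of_real s])"
    and gp: "g (vector [0, 0, complex_of_real s]) = 0" and s: "0 < s" "s < 1"
    and extremal: "cmod c * (1 - s\<^sup>2) = 1" and u: "cmod u = 1"
  shows "Re (complex_of_real (1 - s\<^sup>2) * cnj (complex_of_real (1 - s\<^sup>2) * c) * (a * u + b * cnj u)) \<le> 1 - s"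
proof -
  define e where "e = 1 - s\<^sup>2"
  have e: "e > 0" using s by (simp add: e_def abs_square_less_1)
  define k where "k = e * c"
  have k1: "cmod k = 1" using e extremal by (simp add: k_def norm_mult mult.commute flip: e_def)
  have k2: "cnj k * k = 1" using k1 by (rule unimodular_cnj)
  define m where "m = (\<lambda>z. Moebius_function 0 (- complex_of_real s) (cnj k * z))"
  define H where "H = (\<lambda>x. m (g x))"
  have s1: "cmod (- complex_of_real s) < 1" using s by simp
  have mb: "cmod (m z) < 1" if "cmod z < 1" for z
    unfolding m_def using that k1 by (intro Moebius_function_norm_lt_1[OF s1]) (simp add: norm_mult)
  have md: "\<exists>d. (m has_field_derivative d) (at z)" if "cmod z < 1" for z
  proof -
    have "1 + s * (cnj k * z) \<noteq> 0"
      using one_minus_cnj_mult_nonzero[of "- complex_of_real s" "cnj k * z"] s1 that k1 by (simp add: norm_mult)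
    then show ?thesis unfolding m_def Moebius_function_def
      by (intro exI) (auto intro!: derivative_eq_intros)
  qed
  have disc: "disc_function H"
    unfolding disc_function_def H_def has_some_gradient_def
  proof (intro ballI conjI)
    fix x assume "x \<in> tetrablock"
    then have x: "cmod (g x) < 1" "has_some_gradient g x"
      using g unfolding disc_function_def by auto
    show "cmod (m (g x)) < 1" using mb x by blast
    obtain d where d: "(m has_field_derivative d) (at (g x))" using md[OF x(1)] by blast
    obtain a b c where "has_gradient g a b c x"
      using x(2) unfolding has_some_gradient_def by blast
    from has_gradient_compose_field[OF this d]
    show "\<exists>a b c. has_gradient (\<lambda>x. m (g x)) a b c x" by blast
  qed
  have gradH: "has_gradient H (e * cnj k * a) (e * cnj k * b) (e * cnj k * c) (vector [0, 0, complex_of_real s])"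
    unfolding H_def
  proof (rule has_gradient_compose_field[OF grad])
    show "(m has_field_derivative e * cnj k) (at (g (vector [0, 0, complex_of_real s])))"
      unfolding m_def Moebius_function_def gp
      by (auto intro!: derivative_eq_intros simp: e_def power2_eq_square algebra_simps)
  qed
  have "(\<lambda>l. g (vector [0, 0, l])) holomorphic_on ball 0 1"
    "\<And>l. cmod l < 1 \<Longrightarrow> cmod (g (vector [0, 0, l])) < 1"
    by (rule disc_function_along_disc[OF g, of "\<lambda>_. 0" "\<lambda>_. 0" "\<lambda>l. l"];
        simp add: axis_disc_in_tetrablock)+
  moreover have "((\<lambda>l. g (vector [0, 0, l])) has_field_derivative c) (at (complex_of_real s))"
    using has_gradient_chain_field[of g _ _ _ "\<lambda>_. 0" "complex_of_real s" "\<lambda>_. 0" "\<lambda>l. l" 0 0 1] grad by simp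
  moreover have "cmod c * (1 - (cmod (complex_of_real s))\<^sup>2) = 1" using extremal by simp
  ultimately have ext: "g (vector [0, 0, l]) = k * Moebius_function 0 s l" if "cmod l < 1" for l
    using schwarz_pick_extremal[of "\<lambda>l. g (vector [0, 0, l])" "complex_of_real s" c l]
      that s gp by (simp add: Moebius_function_simple k_def e_def)
  have "H (vector [0, 0, l]) = l" if l: "cmod l < 1" for l
  proof -
    have cancel: "cnj k * (k * Moebius_function 0 s l) = Moebius_function 0 s l"
      unfolding mult.assoc[symmetric] k2 by simp
    show ?thesis unfolding H_def m_def ext[OF l] cancel
      using Moebius_function_compose[of "- complex_of_real s" "complex_of_real s" l] l s by simp
  qed
  from left_inverse_gradient_bound[OF disc this s gradH u]
  show ?thesis by (simp add: k_def e_def algebra_simps)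
qed

section \<open>The magic functions and the rigidity of the axis\<close>

text \<open>
  The value at \<open>w\<close> of the fractional linear map that encodes \<open>x\<close>, now regarded as a function of \<open>x\<close>.
\<close>
definition magic_function :: "complex \<Rightarrow> complex ^ 3 \<Rightarrow> complex" where
  "magic_function w x = (x $ 1 - x $ 3 * w) / (1 - x $ 2 * w)"

lemma disc_function_magic:
  assumes w: "cmod w \<le> 1"
  shows "disc_function (magic_function w)"
  unfolding disc_function_def
proof
  fix x assume "x \<in> tetrablock"
  then have *: "cmod (x $ 1 - x $ 3 * w) < cmod (1 - x $ 2 * w)" using w by (simp add: tetrablock_iff)
  then have nz: "1 - x $ 2 * w \<noteq> 0" by auto
  have "has_some_gradient (magic_function w) x"
    unfolding magic_function_def using nz by (intro has_some_gradient_intros)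
  moreover have "cmod (magic_function w x) < 1" using * nz by (simp add: magic_function_def norm_divide)
  ultimately show "cmod (magic_function w x) < 1 \<and> has_some_gradient (magic_function w) x" by blast
qed

lemma disc_function_compose:
  assumes g: "disc_function g" and F: "mutually_inverse_on tetrablock F G"
  shows "disc_function (\<lambda>x. g (F x))"
  unfolding disc_function_def
proof
  fix x assume x: "x \<in> tetrablock"
  then have Fx: "F x \<in> tetrablock" and "\<forall>i. has_some_gradient (\<lambda>y. F y $ i) x"
    using F unfolding mutually_inverse_on_def analytic_map_on_iff_gradients by auto
  moreover from Fx have "cmod (g (F x)) < 1" "has_some_gradient g (F x)"
    using g unfolding disc_function_def by auto
  ultimately show "cmod (g (F x)) < 1 \<and> has_some_gradient (\<lambda>x. g (F x)) x"
    unfolding has_some_gradient_def by (blast intro: has_gradient_compose)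
qed

lemma magic_gradient:
  "has_gradient (magic_function w) 1 (- (l * w\<^sup>2)) (- w) (vector [0, 0, l])"
proof -
  have f: "has_gradient (\<lambda>x. x $ 1 - x $ 3 * w) 1 0 (- w) (vector [0, 0, l])"
    using has_gradient_diff[OF has_gradient_component(1) has_gradient_mult[OF has_gradient_component(3) has_gradient_const]]
    by simp
  have g: "has_gradient (\<lambda>x. 1 - x $ 2 * w) 0 (- w) 0 (vector [0, 0, l])"
    using has_gradient_diff[OF has_gradient_const has_gradient_mult[OF has_gradient_component(2) has_gradient_const]]
    by simp
  have "magic_function w = (\<lambda>x. (x $ 1 - x $ 3 * w) / (1 - x $ 2 * w))" by (simp add: magic_function_def fun_eq_iff)
  then show ?thesis using has_gradient_divide[OF f g] by (simp add: power2_eq_square mult.assoc)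
qed

lemma magic_flip_gradient:
  "has_gradient (\<lambda>x. magic_function w (flip x)) (- (l * w\<^sup>2)) 1 (- w) (vector [0, 0, l])"
proof -
  have "has_gradient (\<lambda>y. flip y $ 1) 0 1 0 (vector [0, 0, l])"
    "has_gradient (\<lambda>y. flip y $ 2) 1 0 0 (vector [0, 0, l])"
    "has_gradient (\<lambda>y. flip y $ 3) 0 0 1 (vector [0, 0, l])"
    by (simp_all add: flip_def has_gradient_component)
  from has_gradient_compose[OF _ this, of "magic_function w"] magic_gradient[of w l] show ?thesis
    by (fastforce simp: flip_def)
qed

lemma magic_axis: "magic_function w (vector [0, 0, l]) = - (l * w)" "magic_function w (flip (vector [0, 0, l])) = - (l * w)"
  by (simp_all add: magic_function_def flip_def)

text \<open>Compare the values at the four fourth roots of unity; they separate the frequencies \<open>1\<close> and \<open>- 1\<close>.\<close>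
lemma constant_on_circle:
  fixes s :: real and K P Q k :: complex
  assumes "\<And>w::complex. cmod w = 1 \<Longrightarrow> K - cnj w * P + s * w * Q = k"
  shows "P = 0" "s * Q = 0"
proof -
  have "P = s * Q"
  proof -
    have "K - P + s * Q = k" "K + P - s * Q = k" using assms[of 1] assms[of "-1"] by simp_all
    moreover have "2 * (P - s * Q) = (K + P - s * Q) - (K - P + s * Q)" by (simp add: algebra_simps)
    ultimately have "2 * (P - s * Q) = 0" by simp
    then show ?thesis by simp
  qed
  moreover have "P = - (s * Q)"
  proof -
    have "K + \<i> * P + s * \<i> * Q = k" "K - \<i> * P - s * \<i> * Q = k" using assms[of \<i>] assms[of "-\<i>"] by simp_all
    moreover have "2 * \<i> * (P + s * Q) = (K + \<i> * P + s * \<i> * Q) - (K - \<i> * P - s * \<i> * Q)"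
      by (simp add: algebra_simps)
    ultimately have "2 * \<i> * (P + s * Q) = 0" by simp
    then have "P + s * Q = 0" by simp
    then show ?thesis by (simp add: add_eq_0_iff2)
  qed
  ultimately show "P = 0" "s * Q = 0" by auto
qed

text \<open>
  The fourth roots of unity give \<open>P y = - s (cnj (Q y))\<close> and, by symmetry, \<open>Q y = - s (cnj (P y))\<close>. Since
  \<open>s < 1\<close>, both products vanish.
\<close>
lemma real_on_circle:
  fixes s :: real and K P Q y :: complex
  assumes s: "0 \<le> s" "s < 1" and y: "y \<noteq> 0"
    and P: "\<And>w::complex. cmod w = 1 \<Longrightarrow> Im ((K - cnj w * P + s * w * Q) * y) = 0"
    and Q: "\<And>w::complex. cmod w = 1 \<Longrightarrow> Im ((K - cnj w * Q + s * w * P) * y) = 0"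
  shows "P = 0 \<and> Q = 0"
proof -
  have aux: "Im (P * y) = s * Im (Q * y)" "Re (P * y) = - s * Re (Q * y)"
    if "\<And>w::complex. cmod w = 1 \<Longrightarrow> Im ((K - cnj w * P + s * w * Q) * y) = 0" for P Q :: complex
    using that[of 1] that[of "-1"] that[of \<i>] that[of "-\<i>"] by (simp_all add: algebra_simps)
  have "(1 - s\<^sup>2) * X = 0" if "X = r * Y" "Y = r * X" "r * r = s\<^sup>2" for X Y r :: real
  proof -
    have "X = (r * r) * X" using that(1,2) by simp
    then show ?thesis using that(3) by (simp add: algebra_simps)
  qed
  from this[of _ s, OF aux(1)[OF P] aux(1)[OF Q]] this[of _ "- s", OF aux(2)[OF P] aux(2)[OF Q]]
  have "(1 - s\<^sup>2) * Im (P * y) = 0" "(1 - s\<^sup>2) * Re (P * y) = 0"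
    by (simp_all add: power2_eq_square)
  moreover have "1 - s\<^sup>2 > 0" using s by (simp add: abs_square_less_1)
  ultimately have "P * y = 0" by (simp add: complex_eq_iff)
  moreover from this have "Q * y = 0" using aux[OF Q] by (simp add: complex_eq_iff)
  ultimately show ?thesis using y by simp
qed

text \<open>
  The norms \<open>max (\<bar>\<alpha>\<bar> + \<bar>\<beta>\<bar>) \<bar>\<gamma>\<bar>\<close> on covectors and \<open>max \<bar>y1\<bar> \<bar>y2\<bar> + \<bar>y3\<bar>\<close> on vectors are dual to each other, so a
  pairing of value \<open>1\<close> between a covector of norm at most \<open>e\<close> and a vector of norm at most \<open>1 / e\<close> is extremal. In
  particular each of its summands is real and nonnegative.
\<close>
lemma extremal_pairing:
  fixes e t :: real
  assumes e: "e > 0" and sum: "\<alpha> * y1 + \<beta> * y2 + \<gamma> * y3 = 1"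
    and bounds: "cmod \<alpha> + cmod \<beta> \<le> e" "cmod \<gamma> \<le> e"
    and y: "cmod y1 + cmod y3 \<le> 1 / e" "cmod y2 + cmod y3 \<le> 1 / e"
  shows "\<gamma> * y3 = complex_of_real (e * cmod y3)" "Im (\<alpha> * y1) = 0" "Im (\<beta> * y2) = 0"
    and "y3 = 0 \<Longrightarrow> y1 = 0 \<Longrightarrow> \<alpha> = 0"
    and "y3 = 0 \<Longrightarrow> y2 = 0 \<Longrightarrow> \<beta> = 0"
proof -
  have real: "Im z = 0 \<and> Re z = r" if "cmod z \<le> r" "r \<le> Re z" for z r
  proof -
    have "(cmod z)\<^sup>2 \<le> (Re z)\<^sup>2" using that complex_Re_le_cmod[of z] by (intro power_mono) auto
    then have "Im z = 0" by (simp add: cmod_power2)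
    then show ?thesis using that complex_Re_le_cmod[of z] by simp
  qed
  define Y where "Y = 1 / e - cmod y3"
  have "cmod (\<alpha> * y1) + cmod (\<beta> * y2) \<le> cmod \<alpha> * Y + cmod \<beta> * Y"
    unfolding norm_mult using y by (intro add_mono mult_left_mono) (auto simp: Y_def)
  also have "\<dots> \<le> e * Y" unfolding distrib_right[symmetric] using bounds(1) y(1) norm_ge_zero[of y1]
    by (intro mult_right_mono) (auto simp: Y_def simp del: norm_ge_zero)
  also have "\<dots> = 1 - e * cmod y3" using e by (simp add: Y_def field_simps)
  finally have ab: "cmod (\<alpha> * y1) + cmod (\<beta> * y2) \<le> 1 - e * cmod y3" .
  have c: "cmod (\<gamma> * y3) \<le> e * cmod y3" unfolding norm_mult using bounds by (intro mult_right_mono) auto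
  have re: "Re (\<alpha> * y1) + Re (\<beta> * y2) + Re (\<gamma> * y3) = 1" using sum by (metis plus_complex.sel(1) one_complex.sel(1))
  note le = complex_Re_le_cmod[of "\<alpha> * y1"] complex_Re_le_cmod[of "\<beta> * y2"] complex_Re_le_cmod[of "\<gamma> * y3"]
  have "Im (\<gamma> * y3) = 0 \<and> Re (\<gamma> * y3) = e * cmod y3" by (rule real) (use ab c re le in linarith)+
  then show "\<gamma> * y3 = complex_of_real (e * cmod y3)" by (simp add: complex_eq_iff)
  show "Im (\<alpha> * y1) = 0" using real[of "\<alpha> * y1" "cmod (\<alpha> * y1)"] ab c re le by linarith
  show "Im (\<beta> * y2) = 0" using real[of "\<beta> * y2" "cmod (\<beta> * y2)"] ab c re le by linarith
  have other: "q = 0" if "p * z = 1" "cmod q + cmod p \<le> e" "cmod z \<le> 1 / e" for p q z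
  proof -
    have "1 = cmod p * cmod z" using that(1) by (metis norm_mult norm_one)
    also have "\<dots> \<le> cmod p * (1 / e)" using that(3) by (intro mult_left_mono) auto
    finally have "e \<le> cmod p" using e by (simp add: field_simps)
    then have "cmod q \<le> 0" using that(2) by linarith
    then show ?thesis by simp
  qed
  show "\<alpha> = 0" if "y3 = 0" "y1 = 0" using other[of \<beta> y2 \<alpha>] sum bounds y that by simp
  show "\<beta> = 0" if "y3 = 0" "y2 = 0" using other[of \<alpha> y1 \<beta>] sum bounds y that by (simp add: add.commute)
qed

text \<open>
  Here \<open>A\<close>, \<open>B\<close>, \<open>C\<close> are the columns of an invertible matrix \<open>M\<close>, to be thought of as the derivative at the
  origin of an automorphism that maps the origin to \<open>(0, 0, s)\<close>, and \<open>y\<close> is the vector that \<open>M\<close> maps to the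
  axis direction. The bounds are those which Schwarz-Pick imposes on the pullbacks of the magic functions. The
  gradients of these functions at \<open>(0, 0, s)\<close>, multiplied by \<open>- cnj w\<close>, all have third component \<open>1\<close>, so
  their pullbacks pair with \<open>y\<close> to \<open>1\<close> for every unimodular \<open>w\<close>, and all of these pairings are extremal.

  If \<open>y\<^sub>3 \<noteq> 0\<close>, extremality makes the third component of the pullback independent of \<open>w\<close>, which is the claim. If
  \<open>y\<^sub>3 = 0\<close>, it makes the first component times \<open>y\<^sub>1\<close> and the second component times \<open>y\<^sub>2\<close> real for all
  \<open>w\<close>, and a component with vanishing factor is itself zero. In either case the upper entries of \<open>A\<close> and \<open>B\<close>
  vanish, which the invertibility of \<open>M\<close> excludes.
\<close>
lemma axis_direction_rigid:
  fixes s :: real and A B C y :: "3 \<Rightarrow> complex"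
  assumes s: "0 \<le> s" "s < 1"
    and AB: "\<And>w::complex. cmod w = 1 \<Longrightarrow> cmod (A 3 - cnj w * A 1 + s * w * A 2) + cmod (B 3 - cnj w * B 1 + s * w * B 2) \<le> 1 - s\<^sup>2"
      "\<And>w::complex. cmod w = 1 \<Longrightarrow> cmod (A 3 - cnj w * A 2 + s * w * A 1) + cmod (B 3 - cnj w * B 2 + s * w * B 1) \<le> 1 - s\<^sup>2"
    and C: "\<And>w::complex. cmod w = 1 \<Longrightarrow> cmod (C 3 - cnj w * C 1 + s * w * C 2) \<le> 1 - s\<^sup>2"
      "\<And>w::complex. cmod w = 1 \<Longrightarrow> cmod (C 3 - cnj w * C 2 + s * w * C 1) \<le> 1 - s\<^sup>2"
    and y: "\<And>w::complex. cmod w = 1 \<Longrightarrow> cmod (y 1 - w * y 3) * (1 - s\<^sup>2) \<le> 1"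
      "\<And>w::complex. cmod w = 1 \<Longrightarrow> cmod (y 2 - w * y 3) * (1 - s\<^sup>2) \<le> 1"
    and My: "A 1 * y 1 + B 1 * y 2 + C 1 * y 3 = 0" "A 2 * y 1 + B 2 * y 2 + C 2 * y 3 = 0"
      "A 3 * y 1 + B 3 * y 2 + C 3 * y 3 = 1"
    and regular: "A 1 \<noteq> 0 \<or> A 2 \<noteq> 0 \<or> B 1 \<noteq> 0 \<or> B 2 \<noteq> 0"
  shows "C 1 = 0" "C 2 = 0" "cmod (C 3) = 1 - s\<^sup>2"
proof -
  define e where "e = 1 - s\<^sup>2"
  have e: "e > 0" using s by (simp add: e_def abs_square_less_1)
  have yb: "cmod (y i) + cmod (y 3) \<le> 1 / e" if "i = 1 \<or> i = 2" for i
  proof -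
    obtain w where "cmod w = 1" "cmod (y i - w * y 3) = cmod (y i) + cmod (y 3)"
      using unimodular_alignment by blast
    then have "(cmod (y i) + cmod (y 3)) * e \<le> 1" using y[of w] that by (auto simp: e_def)
    then show ?thesis using e by (simp add: field_simps)
  qed
  have pair: "(A 3 - cnj w * A 1 + s * w * A 2) * y 1 + (B 3 - cnj w * B 1 + s * w * B 2) * y 2
      + (C 3 - cnj w * C 1 + s * w * C 2) * y 3 = 1"
    "(A 3 - cnj w * A 2 + s * w * A 1) * y 1 + (B 3 - cnj w * B 2 + s * w * B 1) * y 2
      + (C 3 - cnj w * C 2 + s * w * C 1) * y 3 = 1" for w :: complex
  proof -
    have "(A 3 - cnj w * A i + s * w * A j) * y 1 + (B 3 - cnj w * B i + s * w * B j) * y 2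
      + (C 3 - cnj w * C i + s * w * C j) * y 3
      = (A 3 * y 1 + B 3 * y 2 + C 3 * y 3) - cnj w * (A i * y 1 + B i * y 2 + C i * y 3)
        + s * w * (A j * y 1 + B j * y 2 + C j * y 3)" for i j
      by (simp add: algebra_simps)
    then show "(A 3 - cnj w * A 1 + s * w * A 2) * y 1 + (B 3 - cnj w * B 1 + s * w * B 2) * y 2
      + (C 3 - cnj w * C 1 + s * w * C 2) * y 3 = 1"
      "(A 3 - cnj w * A 2 + s * w * A 1) * y 1 + (B 3 - cnj w * B 2 + s * w * B 1) * y 2
      + (C 3 - cnj w * C 2 + s * w * C 1) * y 3 = 1" using My by simp_all
  qed
  {
    fix w :: complex assume w: "cmod w = 1"
    note extremal_pairing[OF e pair(1)[of w] AB(1)[OF w, folded e_def] C(1)[OF w, folded e_def] yb[OF disjI1[OF refl]] yb[OF disjI2[OF refl]]]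
  }
  note E1 = this
  {
    fix w :: complex assume w: "cmod w = 1"
    note extremal_pairing[OF e pair(2)[of w] AB(2)[OF w, folded e_def] C(2)[OF w, folded e_def] yb[OF disjI1[OF refl]] yb[OF disjI2[OF refl]]]
  }
  note E2 = this
  have y3: "y 3 \<noteq> 0"
  proof
    assume y3: "y 3 = 0"
    have "A 1 = 0 \<and> A 2 = 0"
    proof (cases "y 1 = 0")
      case True
      show ?thesis
        using constant_on_circle(1)[of "A 3" "A 1" s "A 2" 0, OF E1(4)[OF _ y3 True]]
          constant_on_circle(1)[of "A 3" "A 2" s "A 1" 0, OF E2(4)[OF _ y3 True]] by blast
    next
      case False
      show ?thesis by (rule real_on_circle[OF s False E1(2) E2(2)])
    qed
    moreover have "B 1 = 0 \<and> B 2 = 0"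
    proof (cases "y 2 = 0")
      case True
      show ?thesis
        using constant_on_circle(1)[of "B 3" "B 1" s "B 2" 0, OF E1(5)[OF _ y3 True]]
          constant_on_circle(1)[of "B 3" "B 2" s "B 1" 0, OF E2(5)[OF _ y3 True]] by blast
    next
      case False
      show ?thesis by (rule real_on_circle[OF s False E1(3) E2(3)])
    qed
    ultimately show False using regular by blast
  qed
  have "C 3 - cnj w * C 1 + s * w * C 2 = e * cmod (y 3) / y 3"
    "C 3 - cnj w * C 2 + s * w * C 1 = e * cmod (y 3) / y 3" if "cmod w = 1" for w :: complex
    using E1(1)[OF that] E2(1)[OF that] y3 by (simp_all add: field_simps)
  from constant_on_circle(1)[OF this(1)] constant_on_circle(1)[OF this(2)] this(1)[of 1]
  show "C 1 = 0" "C 2 = 0" and "cmod (C 3) = 1 - s\<^sup>2"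
    using y3 e by (simp_all add: norm_divide norm_mult flip: e_def)
qed

section \<open>The orbit of the origin\<close>

lemma jacobian:
  assumes "mutually_inverse_on tetrablock F G" "x \<in> tetrablock"
  obtains A B C where "\<And>i. has_gradient (\<lambda>y. F y $ i) (A i) (B i) (C i) x"
proof -
  have "\<forall>i. \<exists>a b c. has_gradient (\<lambda>y. F y $ i) a b c x"
    using assms unfolding mutually_inverse_on_def analytic_map_on_iff_gradients has_some_gradient_def by blast
  then show ?thesis using that by metis
qed

lemma jacobian_inverse:
  assumes F: "mutually_inverse_on tetrablock F G" and x: "x \<in> tetrablock"
    and A: "\<And>i. has_gradient (\<lambda>y. F y $ i) (A i) (B i) (C i) x"
    and X: "\<And>i. has_gradient (\<lambda>y. G y $ i) (X i) (Y i) (Z i) (F x)"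
  shows "X i * A 1 + Y i * A 2 + Z i * A 3 = (if i = 1 then 1 else 0)"
    "X i * B 1 + Y i * B 2 + Z i * B 3 = (if i = 2 then 1 else 0)"
    "X i * C 1 + Y i * C 2 + Z i * C 3 = (if i = 3 then 1 else 0)"
proof -
  have "has_gradient (\<lambda>y. y $ i) (X i * A 1 + Y i * A 2 + Z i * A 3)
      (X i * B 1 + Y i * B 2 + Z i * B 3) (X i * C 1 + Y i * C 2 + Z i * C 3) x"
    by (rule has_gradient_transform[OF has_gradient_compose[OF X[of i] A[of 1] A[of 2] A[of 3]] open_tetrablock x])
       (use F in \<open>simp add: mutually_inverse_on_def\<close>)
  moreover have "has_gradient (\<lambda>y. y $ i) (if i = 1 then 1 else 0) (if i = 2 then 1 else 0) (if i = 3 then 1 else 0) x"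
    using exhaust_3[of i] has_gradient_component[of x] by auto
  ultimately show "X i * A 1 + Y i * A 2 + Z i * A 3 = (if i = 1 then 1 else 0)"
    "X i * B 1 + Y i * B 2 + Z i * B 3 = (if i = 2 then 1 else 0)"
    "X i * C 1 + Y i * C 2 + Z i * C 3 = (if i = 3 then 1 else 0)"
    using has_gradient_unique by blast+
qed

text \<open>
  Let \<open>M\<close>, with columns \<open>A\<close>, \<open>B\<close>, \<open>C\<close>, be the derivative of \<open>F\<close> at the origin and \<open>N\<close>, with columns \<open>X\<close>,
  \<open>Y\<close>, \<open>Z\<close>, its inverse. By \<open>axis_direction_rigid\<close> both preserve the axis direction. If \<open>s > 0\<close>, the magic
  functions composed with \<open>G\<close> are extremal along the axis at \<open>(0, 0, s)\<close>, and \<open>extremal_gradient_bound\<close> yields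
  \<open>(\<bar>X\<^sub>1\<bar> + \<bar>Y\<^sub>1\<bar>) (1 + s) \<le> 1\<close>. On the other hand \<open>\<bar>A\<^sub>1\<bar>\<close> and \<open>\<bar>A\<^sub>2\<bar>\<close> are at most \<open>1 - s\<^sup>2\<close>, whereas the
  upper left entry of \<open>N M\<close> is \<open>X\<^sub>1 A\<^sub>1 + Y\<^sub>1 A\<^sub>2 = 1\<close>.
\<close>
lemma origin_orbit_meets_axis_only_at_origin:
  assumes F: "mutually_inverse_on tetrablock F G"
    and Fo: "F (vector [0, 0, 0]) = vector [0, 0, complex_of_real s]"
    and s: "0 \<le> s" "s < 1"
  shows "s = 0"
proof (rule ccontr)
  assume "s \<noteq> 0"
  with s have s0: "0 < s" by simp
  define e where "e = 1 - s\<^sup>2"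
  have e: "e > 0" "e = (1 - s) * (1 + s)"
    using s by (simp add: e_def abs_square_less_1) (simp add: e_def power2_eq_square algebra_simps)
  let ?o = "vector [0, 0, 0] :: complex ^ 3" and ?p = "vector [0, 0, complex_of_real s] :: complex ^ 3"
  have o: "?o \<in> tetrablock" and p: "?p \<in> tetrablock" using s by (simp_all add: axis_disc_in_tetrablock)
  have G: "mutually_inverse_on tetrablock G F" using F by (rule mutually_inverse_on_sym)
  have Gp: "G ?p = ?o" using F o Fo unfolding mutually_inverse_on_def by metis
  obtain A B C where M: "\<And>i. has_gradient (\<lambda>y. F y $ i) (A i) (B i) (C i) ?o"
    using jacobian[OF F o] by blast
  obtain X Y Z where N: "\<And>i. has_gradient (\<lambda>y. G y $ i) (X i) (Y i) (Z i) ?p"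
    using jacobian[OF G p] by blast
  note NM = jacobian_inverse[OF F o M N[folded Fo]]
  note MN = jacobian_inverse[OF G p N M[folded Gp]]
  have F_flip: "mutually_inverse_on tetrablock (\<lambda>x. flip (F x)) (\<lambda>x. G (flip x))"
    by (rule mutually_inverse_on_compose[OF F mutually_inverse_flip])
  have G_flip: "mutually_inverse_on tetrablock (\<lambda>x. flip (G x)) (\<lambda>x. F (flip x))"
    by (rule mutually_inverse_on_compose[OF G mutually_inverse_flip])
  \<comment> \<open>The gradients of the magic functions at \<open>(0, 0, s)\<close> are normalised by the factor \<open>- cnj w\<close>.\<close>
  have rotate: "cmod (1 * P + (- (s * w\<^sup>2)) * Q + (- w) * R) = cmod (R - cnj w * P + s * w * Q)"
    if w: "cmod w = 1" for w P Q R :: complex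
  proof -
    have "w * cnj w = 1" using w by (rule unimodular_cnj)
    then have "1 * P + (- (s * w\<^sup>2)) * Q + (- w) * R = (- w) * (R - cnj w * P + s * w * Q)"
      by (simp add: algebra_simps power2_eq_square)
    then show ?thesis using w by (simp add: norm_mult)
  qed
  have swap: "(- (s * w\<^sup>2)) * Q + 1 * P + (- w) * R = 1 * P + (- (s * w\<^sup>2)) * Q + (- w) * R" for w P Q R :: complex
    by simp
  have norm_sw: "(cmod (- (s * w)))\<^sup>2 = s\<^sup>2" if "cmod w = 1" for w :: complex
    using that by (simp add: norm_mult)
  have row1: "cmod (A 3 - cnj w * A 1 + s * w * A 2) + cmod (B 3 - cnj w * B 1 + s * w * B 2) \<le> 1 - s\<^sup>2"
      "cmod (C 3 - cnj w * C 1 + s * w * C 2) \<le> 1 - s\<^sup>2" if w: "cmod w = 1" for w :: complex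
  proof -
    have disc: "disc_function (\<lambda>x. magic_function w (F x))" using w by (intro disc_function_compose[OF _ F] disc_function_magic) simp
    have "has_gradient (magic_function w) 1 (- (s * w\<^sup>2)) (- w) (F ?o)" unfolding Fo by (rule magic_gradient)
    note grad = has_gradient_compose[OF this M[of 1] M[of 2] M[of 3]]
    show "cmod (A 3 - cnj w * A 1 + s * w * A 2) + cmod (B 3 - cnj w * B 1 + s * w * B 2) \<le> 1 - s\<^sup>2"
      using gradient_bound_origin[OF disc grad] unfolding rotate[OF w] Fo magic_axis norm_sw[OF w] .
    show "cmod (C 3 - cnj w * C 1 + s * w * C 2) \<le> 1 - s\<^sup>2"
      using gradient_bound_axis[OF disc grad] unfolding rotate[OF w] Fo magic_axis norm_sw[OF w] by simp
  qed
  have row2: "cmod (A 3 - cnj w * A 2 + s * w * A 1) + cmod (B 3 - cnj w * B 2 + s * w * B 1) \<le> 1 - s\<^sup>2"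
      "cmod (C 3 - cnj w * C 2 + s * w * C 1) \<le> 1 - s\<^sup>2" if w: "cmod w = 1" for w :: complex
  proof -
    have disc: "disc_function (\<lambda>x. magic_function w (flip (F x)))" using w by (intro disc_function_compose[OF _ F_flip] disc_function_magic) simp
    have "has_gradient (\<lambda>x. magic_function w (flip x)) (- (s * w\<^sup>2)) 1 (- w) (F ?o)" unfolding Fo by (rule magic_flip_gradient)
    note grad = has_gradient_compose[OF this M[of 1] M[of 2] M[of 3]]
    show "cmod (A 3 - cnj w * A 2 + s * w * A 1) + cmod (B 3 - cnj w * B 2 + s * w * B 1) \<le> 1 - s\<^sup>2"
      using gradient_bound_origin[OF disc grad] unfolding swap rotate[OF w] Fo magic_axis norm_sw[OF w] .
    show "cmod (C 3 - cnj w * C 2 + s * w * C 1) \<le> 1 - s\<^sup>2"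
      using gradient_bound_axis[OF disc grad] unfolding swap rotate[OF w] Fo magic_axis norm_sw[OF w] by simp
  qed
  have magic_G: "disc_function (\<lambda>x. magic_function w (G x))"
    "has_gradient (\<lambda>x. magic_function w (G x)) (X 1 - w * X 3) (Y 1 - w * Y 3) (Z 1 - w * Z 3) ?p"
    "magic_function w (G ?p) = 0" if w: "cmod w = 1" for w :: complex
  proof -
    show "disc_function (\<lambda>x. magic_function w (G x))" using w by (intro disc_function_compose[OF _ G] disc_function_magic) simp
    have "has_gradient (magic_function w) 1 (- (0 * w\<^sup>2)) (- w) (G ?p)" unfolding Gp by (rule magic_gradient)
    from has_gradient_compose[OF this N[of 1] N[of 2] N[of 3]]
    show "has_gradient (\<lambda>x. magic_function w (G x)) (X 1 - w * X 3) (Y 1 - w * Y 3) (Z 1 - w * Z 3) ?p" by simp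
    show "magic_function w (G ?p) = 0" by (simp add: Gp magic_function_def)
  qed
  have Z1: "cmod (Z 1 - w * Z 3) * (1 - s\<^sup>2) \<le> 1" if w: "cmod w = 1" for w :: complex
    using gradient_bound_axis[OF magic_G(1,2)[OF w]] s magic_G(3)[OF w] by simp
  have Z2: "cmod (Z 2 - w * Z 3) * (1 - s\<^sup>2) \<le> 1" if w: "cmod w = 1" for w :: complex
  proof -
    have disc: "disc_function (\<lambda>x. magic_function w (flip (G x)))" using w by (intro disc_function_compose[OF _ G_flip] disc_function_magic) simp
    have "has_gradient (\<lambda>x. magic_function w (flip x)) (- (0 * w\<^sup>2)) 1 (- w) (G ?p)" unfolding Gp by (rule magic_flip_gradient)
    note grad = has_gradient_compose[OF this N[of 1] N[of 2] N[of 3]]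
    show ?thesis using gradient_bound_axis[OF disc grad] s by (simp add: Gp magic_function_def flip_def)
  qed
  have regular: "A 1 \<noteq> 0 \<or> A 2 \<noteq> 0 \<or> B 1 \<noteq> 0 \<or> B 2 \<noteq> 0"
    using NM(1)[of 1] NM(1)[of 2] NM(2)[of 2] by auto
  have C: "C 1 = 0" "C 2 = 0" "cmod (C 3) = e"
    unfolding e_def
    by (rule axis_direction_rigid[where y = Z and A = A and B = B and s = s];
        use s row1 row2 Z1 Z2 regular MN(3)[of 1] MN(3)[of 2] MN(3)[of 3] in simp)+
  then have Z: "Z 1 = 0" "Z 3 * C 3 = 1" using NM(3)[of 1] NM(3)[of 3] e by auto
  have "cmod (Z 3) * e = 1" using Z(2) C(3) by (metis norm_mult norm_one)
  have half: "cmod (X 1 * u + Y 1 * cnj u) * (1 + s) \<le> 1" if u: "cmod u = 1" for u :: complex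
  proof -
    define \<kappa> where "\<kappa> = Z 3 * e"
    have \<kappa>: "cmod \<kappa> = 1" using \<open>cmod (Z 3) * e = 1\<close> e(1) by (simp add: \<kappa>_def norm_mult)
    let ?U = "\<lambda>u. X 1 * u + Y 1 * cnj u" and ?V = "\<lambda>u. X 3 * u + Y 3 * cnj u"
    have bound: "Re (e * (- (cnj w * cnj \<kappa>)) * (?U u - w * ?V u)) \<le> 1 - s"
      if w: "cmod w = 1" and u: "cmod u = 1" for w u :: complex
    proof -
      have "cmod (Z 1 - w * Z 3) * (1 - s\<^sup>2) = 1"
        using w \<open>cmod (Z 3) * e = 1\<close> Z(1) by (simp add: norm_mult e_def)
      from extremal_gradient_bound[OF magic_G[OF w] s0 s(2) this u]
      have "Re (e * cnj (e * (Z 1 - w * Z 3)) * ((X 1 - w * X 3) * u + (Y 1 - w * Y 3) * cnj u)) \<le> 1 - s"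
        unfolding e_def .
      moreover have eq: "e * cnj (e * (Z 1 - w * Z 3)) * ((X 1 - w * X 3) * u + (Y 1 - w * Y 3) * cnj u)
          = e * (- (cnj w * cnj \<kappa>)) * (?U u - w * ?V u)"
        unfolding Z(1) \<kappa>_def by (simp add: algebra_simps)
      ultimately show ?thesis unfolding eq by blast
    qed
    \<comment> \<open>Averaging over the sign change \<open>(w, u) \<mapsto> (- w, - u)\<close> removes the third row of \<open>N\<close>.\<close>
    obtain v where v: "cmod v = 1" "(- (cnj \<kappa> * ?U u)) * v = cmod (- (cnj \<kappa> * ?U u))"
      using unimodular_multiplier by blast
    define w where "w = cnj v"
    have w: "cmod w = 1" using v by (simp add: w_def)
    have "e * (- (cnj w * cnj \<kappa>)) * (?U u - w * ?V u)
        + e * (- (cnj (- w) * cnj \<kappa>)) * (?U (- u) - (- w) * ?V (- u))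
        = 2 * e * ((- (cnj \<kappa> * ?U u)) * v)"
      by (simp add: w_def algebra_simps)
    also have "\<dots> = complex_of_real (2 * e * cmod (?U u))" unfolding v(2) using \<kappa> by (simp add: norm_mult)
    finally have "Re (e * (- (cnj w * cnj \<kappa>)) * (?U u - w * ?V u))
        + Re (e * (- (cnj (- w) * cnj \<kappa>)) * (?U (- u) - (- w) * ?V (- u))) = 2 * e * cmod (?U u)"
      by (metis Re_complex_of_real plus_complex.sel(1))
    then have "2 * e * cmod (?U u) \<le> 2 * (1 - s)"
      using bound[OF w u] bound[of "- w" "- u"] w u by simp
    then have "(1 - s) * (cmod (?U u) * (1 + s)) \<le> (1 - s) * 1" unfolding e(2) by (simp add: algebra_simps)
    then show ?thesis using s by (simp only: mult_le_cancel_left_pos)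
  qed
  have XY: "(cmod (X 1) + cmod (Y 1)) * (1 + s) \<le> 1"
  proof -
    obtain w where w: "cmod w = 1" "cmod (X 1 - w * Y 1) = cmod (X 1) + cmod (Y 1)"
      using unimodular_alignment by blast
    \<comment> \<open>The square root \<open>u\<close> turns \<open>X\<^sub>1 u + Y\<^sub>1 (cnj u)\<close> into a unimodular multiple of \<open>X\<^sub>1 - w Y\<^sub>1\<close>.\<close>
    define u where "u = csqrt (- cnj w)"
    have "u * u = - cnj w" by (metis power2_csqrt power2_eq_square u_def)
    have "cmod u * cmod u = 1" using w by (simp add: \<open>u * u = - cnj w\<close> flip: norm_mult)
    then have u: "cmod u = 1" by (metis abs_of_nonneg norm_ge_zero norm_one power2_eq_1_iff power2_eq_square real_sqrt_abs2 real_sqrt_one)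
    have uu: "cnj u * cnj u = - w" using \<open>u * u = - cnj w\<close> by (metis complex_cnj_cnj complex_cnj_minus complex_cnj_mult)
    have u1: "cnj u * u = 1" using u by (rule unimodular_cnj)
    have "cnj u * (X 1 * u + Y 1 * cnj u) = X 1 * (cnj u * u) + (cnj u * cnj u) * Y 1"
      by (simp add: algebra_simps)
    then have "cnj u * (X 1 * u + Y 1 * cnj u) = X 1 - w * Y 1" unfolding uu u1 by simp
    then have "cmod (X 1 * u + Y 1 * cnj u) = cmod (X 1) + cmod (Y 1)"
      using w(2) u by (metis complex_mod_cnj mult_1 norm_mult)
    then show ?thesis using half[OF u] by simp
  qed
  \<comment> \<open>Fourier coefficient of frequency \<open>- 1\<close>, computed from the four fourth roots of unity.\<close>
  have small: "cmod P \<le> e"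
    if "\<And>w::complex. cmod w = 1 \<Longrightarrow> cmod (R - cnj w * P + s * w * Q) \<le> e" for P Q R :: complex
  proof -
    have tri: "cmod (- a + b + (- \<i>) * c + \<i> * d) \<le> cmod a + cmod b + cmod c + cmod d" for a b c d
      using norm_triangle_ineq[of "- a + b + (- \<i>) * c" "\<i> * d"] norm_triangle_ineq[of "- a + b" "(- \<i>) * c"]
        norm_triangle_ineq[of "- a" b] by (simp add: norm_mult)
    have "4 * P = - (R - cnj 1 * P + complex_of_real s * 1 * Q) + (R - cnj (-1) * P + complex_of_real s * (-1) * Q)
        + (- \<i>) * (R - cnj \<i> * P + s * \<i> * Q) + \<i> * (R - cnj (-\<i>) * P + s * (-\<i>) * Q)"
      by (simp add: algebra_simps)
    also have "cmod \<dots> \<le> e + e + e + e"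
      by (rule order_trans[OF tri add_mono[OF add_mono[OF add_mono]]]) (rule that; simp)+
    finally show ?thesis by (simp add: norm_mult)
  qed
  have "cmod (A 1) \<le> e"
    by (rule small[of "A 3" _ "A 2"]) (use row1(1) e_def in \<open>smt (verit) norm_ge_zero\<close>)
  moreover have "cmod (A 2) \<le> e"
    by (rule small[of "A 3" _ "A 1"]) (use row2(1) e_def in \<open>smt (verit) norm_ge_zero\<close>)
  moreover have "X 1 * A 1 + Y 1 * A 2 = 1" using NM(1)[of 1] Z(1) by simp
  then have "1 \<le> cmod (X 1) * cmod (A 1) + cmod (Y 1) * cmod (A 2)"
    by (metis norm_mult norm_one norm_triangle_ineq)
  ultimately have "1 \<le> cmod (X 1) * e + cmod (Y 1) * e"
    by (smt (verit) mult_left_mono norm_ge_zero)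
  also have "\<dots> = (1 - s) * ((cmod (X 1) + cmod (Y 1)) * (1 + s))" unfolding e(2) by (simp add: algebra_simps)
  also have "\<dots> \<le> (1 - s) * 1" using XY s by (intro mult_left_mono) auto
  finally show False using s0 by simp
qed

section \<open>The radius is an invariant of the orbit\<close>

text \<open>
  The parameters \<open>a = \<alpha>\<close> and \<open>b = cnj \<theta>\<close> satisfy the equations of \<open>orbit_canonical_form\<close>, because after removal of
  the phases \<open>\<xi>1\<close> and \<open>\<xi>2\<close> these become the relations of \<open>tanh_half_artanh_relations\<close>.
\<close>
lemma orbit_canonical_form_formula:
  assumes x: "x \<in> tetrablock"
    and beta: "cmod \<beta>1 + cmod \<beta>2 < 1"
    and coords: "x = vector [\<beta>1 + cnj \<beta>2 * l, \<beta>2 + cnj \<beta>1 * l, l]"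
    and xi: "cmod \<xi>1 = 1" "cmod \<xi>2 = 1"
      "\<beta>1 = complex_of_real (cmod \<beta>1) * \<xi>1" "cnj \<beta>2 = complex_of_real (cmod \<beta>2) * \<xi>2"
    and alpha: "\<alpha> = \<xi>1 * complex_of_real (tanh (1 / 2 * artanh (cmod \<beta>1 + cmod \<beta>2)
                                      + 1 / 2 * artanh (cmod \<beta>1 - cmod \<beta>2)))"
    and theta: "\<theta> = \<xi>2 * complex_of_real (tanh (1 / 2 * artanh (cmod \<beta>1 + cmod \<beta>2)
                                      - 1 / 2 * artanh (cmod \<beta>1 - cmod \<beta>2)))"
    and r: "r = cmod ((l - \<alpha> * cnj \<theta>) / (cnj \<alpha> * \<theta> * l - 1))"
  shows "(\<exists>f g. mutually_inverse_on tetrablock f g \<and> f x = vector [0, 0, complex_of_real r]) \<and>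
    r < 1 \<and> (r = 0 \<longrightarrow> x $ 3 = x $ 1 * x $ 2)"
proof -
  define p q where "p = cmod \<beta>1" and "q = cmod \<beta>2"
  define t t' where "t = tanh (1 / 2 * artanh (p + q) + 1 / 2 * artanh (p - q))"
    and "t' = tanh (1 / 2 * artanh (p + q) - 1 / 2 * artanh (p - q))"
  have rel: "p + q * t * t' = t" "q + p * t * t' = t'"
    using tanh_half_artanh_relations[OF _ _ _ t_def t'_def] beta by (simp_all add: p_def q_def)
  have \<alpha>: "\<alpha> = \<xi>1 * t" and \<theta>: "\<theta> = \<xi>2 * t'"
    using alpha theta by (simp_all add: t_def t'_def p_def q_def)
  have b: "\<beta>1 = p * \<xi>1" "\<beta>2 = q * cnj \<xi>2"
    using xi(3) arg_cong[OF xi(4), of cnj] by (simp_all add: p_def q_def)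
  have "\<bar>t\<bar> < 1" "\<bar>t'\<bar> < 1" using tanh_real_bounds unfolding t_def t'_def by (simp_all add: abs_less_iff)
  then have norms: "cmod \<alpha> < 1" "cmod (cnj \<theta>) < 1" using xi by (simp_all add: \<alpha> \<theta> norm_mult)
  have unit: "\<xi>1 * cnj \<xi>1 = 1" "\<xi>2 * cnj \<xi>2 = 1"
    using xi(1,2) by (simp_all add: unimodular_cnj)
  have "\<beta>1 + \<alpha> * cnj (cnj \<theta>) * \<beta>2 = p * \<xi>1 + \<xi>1 * t * t' * q * (\<xi>2 * cnj \<xi>2)"
    by (simp add: b \<alpha> \<theta>)
  also have "\<dots> = \<xi>1 * complex_of_real (p + q * t * t')" by (simp add: unit algebra_simps)
  finally have eq1: "\<beta>1 + \<alpha> * cnj (cnj \<theta>) * \<beta>2 = \<alpha>" by (simp only: rel \<alpha>)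
  have "\<beta>2 + cnj \<theta> * cnj \<alpha> * \<beta>1 = q * cnj \<xi>2 + cnj \<xi>2 * t * t' * p * (\<xi>1 * cnj \<xi>1)"
    by (simp add: b \<alpha> \<theta>)
  also have "\<dots> = cnj \<xi>2 * complex_of_real (q + p * t * t')" by (simp add: unit algebra_simps)
  finally have eq2: "\<beta>2 + cnj \<theta> * cnj \<alpha> * \<beta>1 = cnj \<theta>" by (simp only: rel \<theta>) simp
  show ?thesis
    using orbit_canonical_form[OF x coords norms eq1 eq2, of r] r by simp
qed

lemma orbit_meets_axis:
  assumes x: "x \<in> tetrablock"
  obtains f g r where "mutually_inverse_on tetrablock f g" "f x = vector [0, 0, complex_of_real r]"
    "0 \<le> r" "r < 1" "r = 0 \<Longrightarrow> x $ 3 = x $ 1 * x $ 2"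
proof -
  obtain \<beta>1 \<beta>2 where beta: "cmod \<beta>1 + cmod \<beta>2 < 1"
    "x = vector [\<beta>1 + cnj \<beta>2 * x $ 3, \<beta>2 + cnj \<beta>1 * x $ 3, x $ 3]"
    using foliation_coordinates[OF x] by blast
  have polar: "\<exists>u. cmod u = 1 \<and> z = complex_of_real (cmod z) * u" for z
    by (rule exI[of _ "if z = 0 then 1 else z / cmod z"]) (auto simp: norm_divide)
  obtain \<xi>1 \<xi>2 where xi: "cmod \<xi>1 = 1" "cmod \<xi>2 = 1" "\<beta>1 = complex_of_real (cmod \<beta>1) * \<xi>1"
    "cnj \<beta>2 = complex_of_real (cmod \<beta>2) * \<xi>2"
    using polar[of \<beta>1] polar[of "cnj \<beta>2"] by auto
  from orbit_canonical_form_formula[OF x beta xi refl refl refl] that show ?thesis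
    by (metis norm_ge_zero)
qed

text \<open>
  Moving the image of the origin to the axis by an explicit automorphism gives an automorphism that maps the
  origin to the axis, hence to the origin. The explicit automorphism does this only to points of the royal variety.
\<close>
lemma automorphism_origin_royal:
  assumes F: "mutually_inverse_on tetrablock F G"
  shows "F (vector [0, 0, 0]) $ 3 = F (vector [0, 0, 0]) $ 1 * F (vector [0, 0, 0]) $ 2"
proof -
  have "vector [0, 0, 0] \<in> tetrablock" using axis_disc_in_tetrablock[of 0] by simp
  then have q: "F (vector [0, 0, 0]) \<in> tetrablock" using F unfolding mutually_inverse_on_def by blast
  obtain f g r where fg: "mutually_inverse_on tetrablock f g"
      "f (F (vector [0, 0, 0])) = vector [0, 0, complex_of_real r]" and r: "0 \<le> r" "r < 1"
    and royal: "r = 0 \<Longrightarrow> F (vector [0, 0, 0]) $ 3 = F (vector [0, 0, 0]) $ 1 * F (vector [0, 0, 0]) $ 2"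
    using orbit_meets_axis[OF q] by metis
  have "r = 0"
    by (rule origin_orbit_meets_axis_only_at_origin[OF mutually_inverse_on_compose[OF F fg(1)] fg(2) r])
  then show ?thesis by (rule royal)
qed

text \<open>
  On the royal variety the magic function with parameter \<open>w\<close> is the first coordinate, and at \<open>(0, 0, s)\<close> it is
  \<open>- s w\<close>. If \<open>w\<close> has the argument of \<open>q\<^sub>1\<close>, the pseudo-hyperbolic distance of these two values is
  \<open>(s + \<bar>q\<^sub>1\<bar>) / (1 + s \<bar>q\<^sub>1\<bar>)\<close>, which is at least \<open>s\<close>; by Schwarz-Pick it is at most \<open>r\<close>.
\<close>
lemma axis_radius_antimono:
  assumes F: "mutually_inverse_on tetrablock F G"
    and r: "0 \<le> r" "r < 1" and s: "0 \<le> s"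
    and Fr: "F (vector [0, 0, complex_of_real r]) = vector [0, 0, complex_of_real s]"
  shows "s \<le> r"
proof -
  define q where "q = F (vector [0, 0, 0])"
  have "vector [0, 0, 0] \<in> tetrablock" using axis_disc_in_tetrablock[of 0] by simp
  then have q: "q \<in> tetrablock" using F unfolding q_def mutually_inverse_on_def by blast
  have royal: "q $ 3 = q $ 1 * q $ 2" unfolding q_def by (rule automorphism_origin_royal[OF F])
  obtain u where u: "cmod u = 1" "q $ 1 * u = cmod (q $ 1)" using unimodular_multiplier by blast
  define w where "w = cnj u"
  have w: "cmod w = 1" using u by (simp add: w_def)
  have wu: "w * u = 1" using u(1) unfolding w_def by (rule unimodular_cnj)
  let ?h = "\<lambda>l. magic_function w (F (vector [0, 0, l]))"
  have disc: "disc_function (\<lambda>x. magic_function w (F x))" using w by (intro disc_function_compose[OF _ F] disc_function_magic) simp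
  have h: "?h holomorphic_on ball 0 1" "\<And>l. cmod l < 1 \<Longrightarrow> cmod (?h l) < 1"
    by (rule disc_function_along_disc[OF disc, of "\<lambda>_. 0" "\<lambda>_. 0" "\<lambda>l. l"];
        simp add: axis_disc_in_tetrablock)+
  have "1 - q $ 2 * w \<noteq> 0"
    using one_minus_cnj_mult_nonzero[of "cnj (q $ 2)" w] q[unfolded tetrablock_iff, rule_format, of w] w by fastforce
  then have h0: "?h 0 = q $ 1" by (simp add: q_def[symmetric] magic_function_def royal divide_eq_eq algebra_simps)
  have hr: "?h r = - (s * w)" unfolding Fr magic_axis by simp
  let ?a = "cmod (q $ 1)"
  have q1: "q $ 1 = ?a * w" using u(2) wu by (metis mult.assoc mult.commute mult.left_neutral)
  have "?h r - ?h 0 = - (complex_of_real (s + ?a) * w)" unfolding h0 hr by (subst q1) (simp add: algebra_simps)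
  then have d: "cmod (?h r - ?h 0) = s + ?a" using w s by (simp only: norm_minus_cancel norm_mult norm_of_real) simp
  have "cnj (?h 0) * ?h r = - (s * ?a * (cnj w * w))" unfolding h0 hr by (subst q1) simp
  also have "cnj w * w = 1" using w by (rule unimodular_cnj)
  finally have "1 - cnj (?h 0) * ?h r = complex_of_real (1 + s * ?a)" by simp
  then have "cmod (1 - cnj (?h 0) * ?h r) = 1 + s * ?a" using s by (simp only: norm_of_real) simp
  then have *: "s + ?a \<le> r * (1 + s * ?a)" using schwarz_pick[OF h, of r 0] d r by simp
  have "r * (s * ?a) \<le> 1 * (1 * ?a)"
  proof (intro mult_mono)
    have "vector [0, 0, complex_of_real r] \<in> tetrablock" using r by (simp add: axis_disc_in_tetrablock)
    then have "vector [0, 0, complex_of_real s] \<in> tetrablock"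
      using F Fr unfolding mutually_inverse_on_def by metis
    then show "s \<le> 1" using tetrablock_components(3) by fastforce
  qed (use r s in auto)
  then show "s \<le> r" using * by (simp add: algebra_simps)
qed

lemma axis_radius_unique:
  assumes x: "x \<in> tetrablock" and r: "0 \<le> r" "r < 1" and s: "0 \<le> s" "s < 1"
    and f: "mutually_inverse_on tetrablock f f'" "f x = vector [0, 0, complex_of_real r]"
    and g: "mutually_inverse_on tetrablock g g'" "g x = vector [0, 0, complex_of_real s]"
  shows "r = s"
proof -
  have "f' (vector [0, 0, complex_of_real r]) = x" "g' (vector [0, 0, complex_of_real s]) = x"
    using f g x unfolding mutually_inverse_on_def by metis+
  then have "s \<le> r" "r \<le> s"
    using axis_radius_antimono[OF mutually_inverse_on_compose[OF mutually_inverse_on_sym[OF f(1)] g(1)] r s(1)]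
      axis_radius_antimono[OF mutually_inverse_on_compose[OF mutually_inverse_on_sym[OF g(1)] f(1)] s r(1)] f(2) g(2)
    by auto
  then show ?thesis by simp
qed

theorem theorem5p2:
  fixes x :: "complex ^ 3"
  assumes "x \<in> tetrablock"
  shows "(\<exists>!r::real. 0 \<le> r \<and> r < 1 \<and>
            vector [0, 0, complex_of_real r] \<in> aut_orbit tetrablock x) \<and>
    (\<forall>(r::real) (l::complex) \<beta>1 \<beta>2 \<xi>1 \<xi>2 \<alpha> \<theta>.
       0 \<le> r \<longrightarrow> r < 1 \<longrightarrow>
       vector [0, 0, complex_of_real r] \<in> aut_orbit tetrablock x \<longrightarrow>
       cmod l < 1 \<longrightarrow> cmod \<beta>1 + cmod \<beta>2 < 1 \<longrightarrow>
       x = vector [\<beta>1 + cnj \<beta>2 * l, \<beta>2 + cnj \<beta>1 * l, l] \<longrightarrow>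
       cmod \<xi>1 = 1 \<longrightarrow> cmod \<xi>2 = 1 \<longrightarrow>
       \<beta>1 = complex_of_real (cmod \<beta>1) * \<xi>1 \<longrightarrow>
       cnj \<beta>2 = complex_of_real (cmod \<beta>2) * \<xi>2 \<longrightarrow>
       \<alpha> = \<xi>1 * complex_of_real (tanh (1 / 2 * artanh (cmod \<beta>1 + cmod \<beta>2)
                                      + 1 / 2 * artanh (cmod \<beta>1 - cmod \<beta>2))) \<longrightarrow>
       \<theta> = \<xi>2 * complex_of_real (tanh (1 / 2 * artanh (cmod \<beta>1 + cmod \<beta>2)
                                      - 1 / 2 * artanh (cmod \<beta>1 - cmod \<beta>2))) \<longrightarrow>
       r = cmod ((l - \<alpha> * cnj \<theta>) / (cnj \<alpha> * \<theta> * l - 1)))"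
proof -
  have orbit: "y \<in> aut_orbit tetrablock x \<longleftrightarrow> (\<exists>f g. mutually_inverse_on tetrablock f g \<and> f x = y)" for y
    unfolding aut_orbit_def using automorphisms_iff[OF open_tetrablock] by blast
  have unique: "r = s"
    if "0 \<le> r" "r < 1" "vector [0, 0, complex_of_real r] \<in> aut_orbit tetrablock x"
      "0 \<le> s" "s < 1" "vector [0, 0, complex_of_real s] \<in> aut_orbit tetrablock x" for r s :: real
    using axis_radius_unique[OF assms that(1,2,4,5)] that(3,6) unfolding orbit by blast
  show ?thesis
  proof (intro conjI allI impI)
    obtain f g r where "mutually_inverse_on tetrablock f g" "f x = vector [0, 0, complex_of_real r]"
      "0 \<le> r" "r < 1"
      using orbit_meets_axis[OF assms] by metis
    then have "0 \<le> r \<and> r < 1 \<and> vector [0, 0, complex_of_real r] \<in> aut_orbit tetrablock x"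
      unfolding orbit by blast
    then show "\<exists>!r::real. 0 \<le> r \<and> r < 1 \<and> vector [0, 0, complex_of_real r] \<in> aut_orbit tetrablock x"
      using unique by blast
  next
    fix r :: real and l \<beta>1 \<beta>2 \<xi>1 \<xi>2 \<alpha> \<theta> :: complex
    assume r: "0 \<le> r" "r < 1" "vector [0, 0, complex_of_real r] \<in> aut_orbit tetrablock x"
      and h: "cmod \<beta>1 + cmod \<beta>2 < 1" "x = vector [\<beta>1 + cnj \<beta>2 * l, \<beta>2 + cnj \<beta>1 * l, l]"
       "cmod \<xi>1 = 1" "cmod \<xi>2 = 1" "\<beta>1 = complex_of_real (cmod \<beta>1) * \<xi>1"
       "cnj \<beta>2 = complex_of_real (cmod \<beta>2) * \<xi>2"
       "\<alpha> = \<xi>1 * complex_of_real (tanh (1 / 2 * artanh (cmod \<beta>1 + cmod \<beta>2)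
                                      + 1 / 2 * artanh (cmod \<beta>1 - cmod \<beta>2)))"
       "\<theta> = \<xi>2 * complex_of_real (tanh (1 / 2 * artanh (cmod \<beta>1 + cmod \<beta>2)
                                      - 1 / 2 * artanh (cmod \<beta>1 - cmod \<beta>2)))"
    define r' where "r' = cmod ((l - \<alpha> * cnj \<theta>) / (cnj \<alpha> * \<theta> * l - 1))"
    have "vector [0, 0, complex_of_real r'] \<in> aut_orbit tetrablock x" "r' < 1"
      using orbit_canonical_form_formula[OF assms h r'_def] unfolding orbit by auto
    moreover have "0 \<le> r'" by (simp add: r'_def)
    ultimately have "r = r'" by (intro unique r)
    then show "r = cmod ((l - \<alpha> * cnj \<theta>) / (cnj \<alpha> * \<theta> * l - 1))" by (simp add: r'_def)
  qed
qed

end
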